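(* For every integer $d\ge1$ and all sufficiently large $N$, \[ \mathfrak{S}_{\mathbb{R}^d}(N)\gtrsim_d (\log N)^d \quad\text{and}\quad \mathfrak{M}_{\mathbb{R}^d}(N)\gtrsim_d (\log N)^d. \]
   Context: Notation: $X\gtrsim_d Y$ means $X\ge c_d Y$ for a constant $c_d>0$ depending only on $d$. A weight is a nonnegative locally integrable function. For $u_0\in \mathrm{L}^2(\mathbb{R}^d)$ with compactly supported Fourier transform put \[ u(x,t)=\int_{\mathbb{R}^d}\widehat{u_0}(\xi) e^{2\pi i(x\cdot \xi+t|\xi|^2)}\,\mathrm{d}\xi,\quad (x,t)\in\mathbb{R}^d\times\mathbb{R}, \] and for a weight $w$ on $\mathbb{R}^d\times\mathbb{R}$ put $\rho^{\ast}w(x,v)=\int_{\mathbb{R}}w(x-2tv,t)\,\mathrm{d}t\in[0,\infty]$ for $x,v\in\mathbb{R}^d$, with $0\cdot\infty=0$. For $N\ge1$, $\mathfrak{S}_{\mathbb{R}^d}(N)$ is the least constant $C\in[0,\infty]$ such that \[ \int_0^1\int_{\mathbb{R}^d}|u(x,t)|^2w(x,t)\,\mathrm{d}x\,\mathrm{d}t \le C\int_{\mathbb{R}^d}|\widehat{u_0}(v)|^2\sup_{x\in\mathbb{R}^d}\rho^{\ast}w(x,v)\,\mathrm{d}v, \] and $\mathfrak{M}_{\mathbb{R}^d}(N)$ is the least constant $C\in[0,\infty]$ such that \[ \int_0^1\int_{\mathbb{R}^d}|u(x,t)|^2w(x,t)\,\mathrm{d}x\,\mathrm{d}t \le C\sup_{x\in\mathbb{R}^d,\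 v\in\operatorname{supp}\widehat{u_0}}\rho^{\ast}w(x,v)\ \|u_0\|_{\mathrm{L}^2(\mathbb{R}^d)}^2, \] in each case for all weights $w$ on $\mathbb{R}^d\times\mathbb{R}$ and all $u_0\in\mathrm{L}^2(\mathbb{R}^d)$ with $\operatorname{supp}\widehat{u_0}\subseteq[-N,N]^d$. *)

theory Defs
  imports "HOL-Analysis.Analysis"
begin

definition square_integrable :: "(real ^ 'd \<Rightarrow> complex) \<Rightarrow> bool" where
  "square_integrable f \<longleftrightarrow>
     f \<in> borel_measurable lborel \<and> integrable lborel (\<lambda>x. (cmod (f x))\<^sup>2)"

definition L2_norm_sq :: "(real ^ 'd \<Rightarrow> complex) \<Rightarrow> ennreal" where
  "L2_norm_sq f = (\<integral>\<^sup>+ x. ennreal ((cmod (f x))\<^sup>2) \<partial>lborel)"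

definition fourier_integral :: "(real ^ 'd \<Rightarrow> complex) \<Rightarrow> real ^ 'd \<Rightarrow> complex" where
  "fourier_integral f \<xi> =
     (\<integral> x. f x * exp (- (2 * pi * \<i> * of_real (x \<bullet> \<xi>))) \<partial>lborel)"

text \<open>
  The Fourier transform on \<open>L\<^sup>2\<close> is the continuous extension of the Fourier integral from
  \<open>L\<^sup>1 \<inter> L\<^sup>2\<close>. Its value is only determined almost everywhere, so it is given as a relation:
  \<open>g\<close> is a representative of the transform of \<open>f\<close>.
\<close>

definition is_fourier_transform ::
    "(real ^ 'd \<Rightarrow> complex) \<Rightarrow> (real ^ 'd \<Rightarrow> complex) \<Rightarrow> bool" where
  "is_fourier_transform f g \<longleftrightarrow> square_integrable f \<and> square_integrable g \<and>
     (\<exists>\<phi> :: nat \<Rightarrow> real ^ 'd \<Rightarrow> complex.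
        (\<forall>n. integrable lborel (\<phi> n) \<and> square_integrable (\<phi> n)) \<and>
        (\<lambda>n. L2_norm_sq (\<lambda>x. \<phi> n x - f x)) \<longlonglongrightarrow> 0 \<and>
        (\<lambda>n. L2_norm_sq (\<lambda>\<xi>. fourier_integral (\<phi> n) \<xi> - g \<xi>)) \<longlonglongrightarrow> 0)"

text \<open>The support of an almost-everywhere class: it does not depend on the representative.\<close>

definition ess_support :: "(real ^ 'd \<Rightarrow> complex) \<Rightarrow> (real ^ 'd) set" where
  "ess_support g =
     {v. \<forall>U. open U \<and> v \<in> U \<longrightarrow> \<not> (AE \<xi> in lborel. \<xi> \<in> U \<longrightarrow> g \<xi> = 0)}"

definition schroedinger :: "(real ^ 'd \<Rightarrow> complex) \<Rightarrow> real ^ 'd \<Rightarrow> real \<Rightarrow> complex" where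
  "schroedinger g x t =
     (\<integral> \<xi>. g \<xi> * exp (2 * pi * \<i> * of_real (x \<bullet> \<xi> + t * (norm \<xi>)\<^sup>2)) \<partial>lborel)"

text \<open>
  Weights are Borel functions defined everywhere, so that their integrals along individual lines
  make sense.
\<close>

definition weight :: "((real ^ 'd) \<times> real \<Rightarrow> real) \<Rightarrow> bool" where
  "weight w \<longleftrightarrow> w \<in> borel_measurable borel \<and> (\<forall>p. 0 \<le> w p) \<and>
     (\<forall>K. compact K \<longrightarrow> set_integrable lborel K w)"

definition rho_star ::
    "((real ^ 'd) \<times> real \<Rightarrow> real) \<Rightarrow> real ^ 'd \<Rightarrow> real ^ 'd \<Rightarrow> ennreal" where
  "rho_star w x v = (\<integral>\<^sup>+ t. ennreal (w (x - (2 * t) *\<^sub>R v, t)) \<partial>lborel)"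

definition weighted_energy ::
    "(real ^ 'd \<Rightarrow> complex) \<Rightarrow> ((real ^ 'd) \<times> real \<Rightarrow> real) \<Rightarrow> ennreal" where
  "weighted_energy g w =
     (\<integral>\<^sup>+ t\<in>{0..1}. (\<integral>\<^sup>+ x. ennreal ((cmod (schroedinger g x t))\<^sup>2 * w (x, t)) \<partial>lborel) \<partial>lborel)"

definition freq_cube :: "real \<Rightarrow> (real ^ 'd) set" where
  "freq_cube N = cbox (\<chi> i. - N) (\<chi> i. N)"

text \<open>
  Below, the supremum over \<open>x\<close> need not be Borel measurable in \<open>v\<close>, but it is Lebesgue
  measurable (its superlevel sets are projections of Borel sets); hence \<open>lebesgue\<close>.
\<close>

definition S_admissible :: "'d::finite itself \<Rightarrow> real \<Rightarrow> ennreal \<Rightarrow> bool" where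
  "S_admissible _ N C \<longleftrightarrow>
     (\<forall>(w :: (real ^ 'd) \<times> real \<Rightarrow> real) u0 g.
        weight w \<and> is_fourier_transform u0 g \<and> ess_support g \<subseteq> freq_cube N \<longrightarrow>
        weighted_energy g w
          \<le> C * (\<integral>\<^sup>+ v. ennreal ((cmod (g v))\<^sup>2) * (SUP x. rho_star w x v) \<partial>lebesgue))"

definition M_admissible :: "'d::finite itself \<Rightarrow> real \<Rightarrow> ennreal \<Rightarrow> bool" where
  "M_admissible _ N C \<longleftrightarrow>
     (\<forall>(w :: (real ^ 'd) \<times> real \<Rightarrow> real) u0 g.
        weight w \<and> is_fourier_transform u0 g \<and> ess_support g \<subseteq> freq_cube N \<longrightarrow>
        weighted_energy g w
          \<le> C * (SUP (x, v) \<in> UNIV \<times> ess_support g. rho_star w x v) * L2_norm_sq u0)"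

definition S_const :: "'d::finite itself \<Rightarrow> real \<Rightarrow> ennreal" where
  "S_const d N = Inf {C. S_admissible d N C}"

definition M_const :: "'d::finite itself \<Rightarrow> real \<Rightarrow> ennreal" where
  "M_const d N = Inf {C. M_admissible d N C}"

end

theory Submission imports Defs "HOL-Real_Asymp.Real_Asymp" begin

text \<open>
  Fix \<open>D = CARD('d)\<close> and \<open>L \<approx> ln N\<close>, up to a factor depending on \<open>D\<close>. For every coordinate \<open>j\<close>
  choose \<open>L\<close> frequencies \<open>k \<le> N\<close> among the powers of \<open>B = 2 * D + 2\<close>, without repetition; the geometric
  growth is what limits \<open>L\<close> to a logarithm. Picking one frequency per coordinate gives a grid of
  \<open>L ^ D\<close> points of \<open>\<int>\<^sup>D\<close>, the nodes. Let \<open>U\<close> be the sum of the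
  plane waves \<open>e(x \<bullet> \<xi> + t * |\<xi>|\<^sup>2)\<close> over the nodes \<open>\<xi>\<close>, where \<open>e(y) = exp(2 \<pi> i y)\<close>, and take as weight the
  Riesz product, over all coordinates \<open>j\<close> and frequencies \<open>k\<close>, of the factors
  \<open>1 + cos(2 \<pi> (k * x\<^sub>j + k\<^sup>2 * t))\<close>, restricted to times in \<open>[0,1]\<close>. Both are periodic in \<open>x\<close>. Line integrals and energy behave differently.

  Along lines nothing is gained. The Fourier coefficients of the Riesz product sit at signed sums
  \<open>\<Sum> c * (k, k\<^sup>2)\<close> with \<open>c \<in> {-1, 0, 1}\<close>, and a line in the direction of a node \<open>v\<close> sees only those
  with \<open>\<Sum> c * (k\<^sup>2 - 2 * k * v\<^sub>j) = 0\<close>. Reading this equation in base \<open>B\<close> (no carries occur), the digit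
  at \<open>k\<^sup>2\<close> is \<open>c\<close> plus an even number, so every \<open>c\<close> vanishes (\<open>frequencies_nonresonant\<close>). Each such
  line integral is therefore exactly \<open>1\<close> (\<open>riesz_line_mean\<close>), hence at most \<open>2\<close> for directions near a
  node (\<open>rho_star_riesz_weight_le\<close>).

  In the energy everything adds up. All Fourier coefficients of the Riesz product are nonnegative,
  and the differences \<open>(\<xi> - \<xi>', |\<xi>|\<^sup>2 - |\<xi>'|\<^sup>2)\<close> of two nodes are signed sums with coefficient at
  least \<open>4 powr (- D)\<close>. So each of the \<open>L ^ (2 * D)\<close> pairs of nodes contributes at least that much to
  the mean of \<open>|U|\<^sup>2\<close> against the weight (\<open>wave_riesz_mean\<close>), whereas the mean of \<open>|U|\<^sup>2\<close> is only
  \<open>L ^ D\<close>. The quotient is of order \<open>L ^ D\<close>.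

  To pass to \<open>\<real>\<^sup>D\<close>, each node is thickened to a product of tent functions of a tiny width \<open>\<epsilon>\<close>. The
  inverse transform is an exponential sum times a product of Fejer kernels, explicit and integrable,
  so the relation \<open>is_fourier_transform\<close> holds with a constant approximating sequence. On the box of
  side \<open>2 * R\<close> with \<open>R = 1 / (32 * D * \<epsilon>)\<close> the solution is close to \<open>U\<close> times a single wave packet of
  size comparable to \<open>\<epsilon> ^ D\<close>, so the periodic computation survives (\<open>energy_lower\<close>).
\<close>

section \<open>The additive character and product integrals\<close>

definition ee :: "real \<Rightarrow> complex" where "ee y = cis (2 * pi * y)"

lemma ee_add: "ee (x + y) = ee x * ee y"
  by (simp add: ee_def cis_mult distrib_left)

lemma ee_diff: "ee (x - y) = ee x * cnj (ee y)"
  by (simp add: ee_def cis_mult cis_cnj right_diff_distrib)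

lemma ee_minus: "ee (- x) = cnj (ee x)"
  by (simp add: ee_def cis_cnj)

lemma ee_0 [simp]: "ee 0 = 1"
  by (simp add: ee_def)

lemma ee_of_int [simp]: "ee (of_int n) = 1"
  unfolding ee_def by (rule cis_multiple_2pi) simp

lemma norm_ee [simp]: "cmod (ee y) = 1"
  by (simp add: ee_def)

lemma ee_sum: "ee (\<Sum>i\<in>A. f i) = (\<Prod>i\<in>A. ee (f i))"
  by (induction A rule: infinite_finite_induct) (simp_all add: ee_add)

lemma exp_eq_ee: "exp (2 * pi * \<i> * of_real y) = ee y"
  by (simp add: ee_def cis_conv_exp mult_ac)

lemma exp_neg_eq_ee: "exp (- (2 * pi * \<i> * of_real y)) = ee (- y)"
  by (simp add: ee_def cis_conv_exp mult_ac)

lemma cos_eq_ee: "complex_of_real (cos (2 * pi * y)) = (ee y + ee (- y)) / 2"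
  by (simp add: ee_def complex_eq_iff)

lemma continuous_on_ee [continuous_intros]:
  "continuous_on S f \<Longrightarrow> continuous_on S (\<lambda>x. ee (f x))"
  unfolding ee_def by (intro continuous_intros)

lemma borel_measurable_ee [measurable]: "ee \<in> borel_measurable borel"
  by (intro borel_measurable_continuous_onI continuous_intros)

lemma norm_ee_diff_le: "cmod (ee x - ee y) \<le> 2 * pi * \<bar>x - y\<bar>"
proof -
  have "ee x - ee y = ee y * (ee (x - y) - 1)"
    using ee_add[of y "x - y"] by (simp add: algebra_simps)
  then have "cmod (ee x - ee y) = cmod (exp (\<i> * of_real (2 * pi * (x - y))) - 1)"
    by (simp add: norm_mult ee_def cis_conv_exp)
  also have "\<dots> = 2 * \<bar>sin (pi * (x - y))\<bar>"
    using dist_exp_i_1[of "2 * pi * (x - y)"] by simp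
  also have "\<dots> \<le> 2 * \<bar>pi * (x - y)\<bar>"
    using abs_sin_x_le_abs_x[of "pi * (x - y)"] by linarith
  finally show ?thesis by (simp add: abs_mult)
qed

text \<open>
  Lebesgue measure on a Euclidean space is the product of its coordinate measures, so the integral of
  a product of functions of one coordinate each factorises. All integrals in space below have this form.
\<close>

lemma lborel_prod_basis:
  fixes f :: "'a::euclidean_space \<Rightarrow> real \<Rightarrow> complex"
  assumes "\<And>b. b \<in> Basis \<Longrightarrow> integrable lborel (f b)"
  shows "integrable lborel (\<lambda>x::'a. \<Prod>b\<in>Basis. f b (x \<bullet> b))"
    and "(\<integral>x. (\<Prod>b\<in>(Basis :: 'a set). f b (x \<bullet> b)) \<partial>lborel) = (\<Prod>b\<in>Basis. integral\<^sup>L lborel (f b))"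
proof -
  interpret product_sigma_finite "\<lambda>_::'a. lborel :: real measure" ..
  note [measurable] = borel_measurable_integrable[OF assms, simplified]
  have coord: "(\<Sum>b\<in>Basis. y b *\<^sub>R b) \<bullet> c = y c" if "c \<in> Basis" for y :: "'a \<Rightarrow> real" and c
    using that by simp
  show "integrable lborel (\<lambda>x::'a. \<Prod>b\<in>Basis. f b (x \<bullet> b))"
    using product_integrable_prod[OF finite_Basis assms]
    by (subst lborel_eq, subst integrable_distr_eq) (simp_all add: coord cong: prod.cong)
  show "(\<integral>x. (\<Prod>b\<in>(Basis :: 'a set). f b (x \<bullet> b)) \<partial>lborel) = (\<Prod>b\<in>Basis. integral\<^sup>L lborel (f b))"
    using product_integral_prod[OF finite_Basis assms]
    by (subst lborel_eq, subst integral_distr) (simp_all add: coord cong: prod.cong)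
qed

lemma prod_Basis_vec: "(\<Prod>b\<in>(Basis :: (real ^ 'd) set). f b) = (\<Prod>j\<in>UNIV. f (axis j 1))"
proof -
  have "(Basis :: (real ^ 'd) set) = range (\<lambda>j. axis j 1)"
    by (auto simp: Basis_vec_def)
  moreover have "inj (\<lambda>j. axis j 1 :: real ^ 'd)"
    by (auto intro!: injI simp: axis_eq_axis)
  ultimately show ?thesis by (metis (no_types, lifting) comp_apply prod.cong prod.reindex)
qed

lemma lborel_prod_vec:
  fixes f :: "'d::finite \<Rightarrow> real \<Rightarrow> complex"
  assumes "\<And>j. integrable lborel (f j)"
  shows "integrable lborel (\<lambda>x::real ^ 'd. \<Prod>j\<in>UNIV. f j (x $ j))"
    and "(\<integral>x. (\<Prod>j\<in>UNIV. f j ((x :: real ^ 'd) $ j)) \<partial>lborel) = (\<Prod>j\<in>UNIV. integral\<^sup>L lborel (f j))"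
proof -
  show "integrable lborel (\<lambda>x::real ^ 'd. \<Prod>j\<in>UNIV. f j (x $ j))"
    using lborel_prod_basis(1)[of "\<lambda>b :: real ^ 'd. f (axis_index b)"] assms
    by (simp add: prod_Basis_vec axis_index_axis inner_axis)
  show "(\<integral>x. (\<Prod>j\<in>UNIV. f j ((x :: real ^ 'd) $ j)) \<partial>lborel) = (\<Prod>j\<in>UNIV. integral\<^sup>L lborel (f j))"
    using lborel_prod_basis(2)[of "\<lambda>b :: real ^ 'd. f (axis_index b)"] assms
    by (simp add: prod_Basis_vec axis_index_axis inner_axis)
qed

text \<open>
  Over an interval of integer length only the frequency zero survives.
\<close>

lemma integral_ee_interval:
  fixes a b :: real and m p :: int
  assumes "a \<le> b" and p: "b - a = of_int p"
  shows "(\<integral>x. indicator {a..b} x *\<^sub>R ee (of_int m * x) \<partial>lborel) = (if m = 0 then of_real (b - a) else 0)"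
proof (cases "m = 0")
  case True
  have "(\<integral>x. indicator {a..b} x *\<^sub>R (1::complex) \<partial>lborel) = of_real (b - a)"
    using assms(1) by (simp add: scaleR_conv_of_real measure_def)
  with True show ?thesis by simp
next
  case False
  define F where "F x = ee (of_int m * x) / (2 * pi * \<i> * of_int m)" for x
  have "(F has_vector_derivative ee (of_int m * x)) (at x within {a..b})" for x
  proof -
    have "((\<lambda>x. exp (of_real x * (2 * pi * \<i> * of_int m))) has_vector_derivative
       (2 * pi * \<i> * of_int m) * exp (of_real x * (2 * pi * \<i> * of_int m))) (at x within {a..b})"
      using exp_scaleR_has_vector_derivative_right[of "2 * pi * \<i> * of_int m" x "{a..b}"]
      by (simp add: scaleR_conv_of_real mult_ac)
    then have "((\<lambda>x. exp (of_real x * (2 * pi * \<i> * of_int m)) / (2 * pi * \<i> * of_int m)) has_vector_derivative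
       ((2 * pi * \<i> * of_int m) * exp (of_real x * (2 * pi * \<i> * of_int m))) / (2 * pi * \<i> * of_int m)) (at x within {a..b})"
      by (rule has_vector_derivative_divide)
    moreover have "exp (of_real x * (2 * pi * \<i> * of_int m)) = ee (of_int m * x)" for x
      by (simp add: exp_eq_ee[symmetric] mult_ac)
    ultimately show ?thesis using False unfolding F_def by simp
  qed
  then have "(\<integral>x. indicator {a..b} x *\<^sub>R ee (of_int m * x) \<partial>lborel) = F b - F a"
    using \<open>a \<le> b\<close> by (intro integral_FTC_atLeastAtMost continuous_intros) auto
  also have "of_int m * b = of_int (m * p) + of_int m * a"
    using p by (simp add: algebra_simps)
  then have "ee (of_int m * b) = ee (of_int m * a)"
    by (metis ee_add ee_of_int mult_1)
  then have "F b - F a = 0" by (simp add: F_def)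
  finally show ?thesis using False by simp
qed

lemma integrable_ee_interval: "integrable lborel (\<lambda>x. indicator {a..b::real} x *\<^sub>R ee (r * x))"
  using borel_integrable_atLeastAtMost'[of a b "\<lambda>x. ee (r * x)"]
  by (simp add: set_integrable_def continuous_intros)

section \<open>The Fejer kernel and its Fourier transform\<close>

text \<open>
  Writing \<open>1 / x\<^sup>2\<close> as a Laplace transform turns \<open>(1 - cos (a * x)) / x\<^sup>2\<close> into an integrand with elementary
  primitives in both variables; positivity allows the order of integration to be exchanged.
\<close>

lemma nn_integral_laplace_inverse_square:
  fixes x :: real
  assumes "x > 0"
  shows "(\<integral>\<^sup>+s. ennreal (s * exp (- (s * x))) * indicator {0..} s \<partial>lborel) = ennreal (1 / x\<^sup>2)"
proof -
  define F where "F s = - (s / x + 1 / x\<^sup>2) * exp (- (s * x))" for s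
  have "DERIV F s :> s * exp (- (s * x))" for s
    unfolding F_def using assms
    by (auto intro!: derivative_eq_intros simp: field_simps power2_eq_square)
  moreover have "(F \<longlongrightarrow> 0) at_top"
    unfolding F_def using assms by real_asymp
  ultimately have "(\<integral>\<^sup>+s. ennreal (s * exp (- (s * x))) * indicator {0..} s \<partial>lborel) = ennreal (0 - F 0)"
    by (intro nn_integral_FTC_atLeast) auto
  then show ?thesis by (simp add: F_def)
qed

lemma nn_integral_laplace_one_minus_cos:
  fixes s a :: real
  assumes "s > 0"
  shows "(\<integral>\<^sup>+x. ennreal ((1 - cos (a * x)) * exp (- (s * x))) * indicator {0..} x \<partial>lborel)
     = ennreal (1 / s - s / (s\<^sup>2 + a\<^sup>2))"
proof -
  have pos: "s\<^sup>2 + a\<^sup>2 > 0" using assms by (simp add: add_pos_nonneg)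
  define F where "F x = exp (- (s * x)) * ((s * cos (a * x) - a * sin (a * x)) / (s\<^sup>2 + a\<^sup>2) - 1 / s)" for x
  have "DERIV F x :> (1 - cos (a * x)) * exp (- (s * x))" for x
  proof -
    have "DERIV F x :> - s * exp (- (s * x)) * ((s * cos (a * x) - a * sin (a * x)) / (s\<^sup>2 + a\<^sup>2) - 1 / s)
        + exp (- (s * x)) * (((- (s * a * sin (a * x)) - a * a * cos (a * x))) / (s\<^sup>2 + a\<^sup>2))"
    proof -
      have "DERIV (\<lambda>x. exp (- (s * x)) * ((s * cos (a * x) - a * sin (a * x)) * k - 1 / s)) x
        :> - s * exp (- (s * x)) * ((s * cos (a * x) - a * sin (a * x)) * k - 1 / s)
          + exp (- (s * x)) * ((- (s * a * sin (a * x)) - a * a * cos (a * x)) * k)" for k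
        by (auto intro!: derivative_eq_intros simp: algebra_simps)
      from this[of "inverse (s\<^sup>2 + a\<^sup>2)"] show ?thesis
        unfolding F_def divide_inverse[of _ "s\<^sup>2 + a\<^sup>2"] .
    qed
    also have "- s * exp (- (s * x)) * ((s * cos (a * x) - a * sin (a * x)) / (s\<^sup>2 + a\<^sup>2) - 1 / s)
        + exp (- (s * x)) * (((- (s * a * sin (a * x)) - a * a * cos (a * x))) / (s\<^sup>2 + a\<^sup>2))
      = exp (- (s * x)) * (1 - cos (a * x) * (s\<^sup>2 + a\<^sup>2) / (s\<^sup>2 + a\<^sup>2))"
    proof -
      have "- s * E * ((s * C - a * S) / Q - 1 / s) + E * ((- (s * a * S) - a * a * C) / Q)
          = E * (1 - C * (s\<^sup>2 + a\<^sup>2) / Q)" if "Q > 0" for E C S Q :: real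
        using assms that by (simp add: divide_simps) (simp add: power2_eq_square algebra_simps)
      from this[OF pos] show ?thesis .
    qed
    finally show ?thesis using pos assms by (simp add: mult.commute)
  qed
  moreover have "(F \<longlongrightarrow> 0) at_top"
  proof -
    have "((\<lambda>x. exp (- (s * x))) \<longlongrightarrow> 0) at_top"
      using assms by real_asymp
    moreover have "norm ((s * cos (a * x) - a * sin (a * x)) / (s\<^sup>2 + a\<^sup>2) - 1 / s)
        \<le> (s + \<bar>a\<bar>) / (s\<^sup>2 + a\<^sup>2) + 1 / s" for x
    proof -
      have "\<bar>s * cos (a * x)\<bar> \<le> s" using assms by (simp add: abs_mult mult_left_le)
      moreover have "\<bar>a * sin (a * x)\<bar> \<le> \<bar>a\<bar>" by (simp add: abs_mult mult_left_le)
      ultimately have "\<bar>s * cos (a * x) - a * sin (a * x)\<bar> \<le> s + \<bar>a\<bar>" by linarith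
      then have "\<bar>(s * cos (a * x) - a * sin (a * x)) / (s\<^sup>2 + a\<^sup>2)\<bar> \<le> (s + \<bar>a\<bar>) / (s\<^sup>2 + a\<^sup>2)"
        using pos by (simp add: divide_right_mono)
      then show "norm ((s * cos (a * x) - a * sin (a * x)) / (s\<^sup>2 + a\<^sup>2) - 1 / s)
        \<le> (s + \<bar>a\<bar>) / (s\<^sup>2 + a\<^sup>2) + 1 / s"
        using assms by (smt (verit) divide_pos_pos real_norm_def)
    qed
    ultimately have "((\<lambda>x. exp (- (s * x)) * ((s + \<bar>a\<bar>) / (s\<^sup>2 + a\<^sup>2) + 1 / s)) \<longlongrightarrow> 0) at_top"
      and "\<forall>\<^sub>F x in at_top. norm (F x) \<le> exp (- (s * x)) * ((s + \<bar>a\<bar>) / (s\<^sup>2 + a\<^sup>2) + 1 / s)"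
      by (auto simp: F_def abs_mult intro!: tendsto_mult_left_zero)
    then show ?thesis by (rule Lim_null_comparison[rotated])
  qed
  ultimately have "(\<integral>\<^sup>+x. ennreal ((1 - cos (a * x)) * exp (- (s * x))) * indicator {0..} x \<partial>lborel) = ennreal (0 - F 0)"
    by (intro nn_integral_FTC_atLeast) auto
  then show ?thesis by (simp add: F_def)
qed

lemma nn_integral_one_minus_cos_half:
  fixes a :: real
  shows "(\<integral>\<^sup>+x. ennreal ((1 - cos (a * x)) / x\<^sup>2) * indicator {0..} x \<partial>lborel) = ennreal (pi * \<bar>a\<bar> / 2)"
proof -
  have pos: "(\<integral>\<^sup>+x. ennreal ((1 - cos (a * x)) / x\<^sup>2) * indicator {0..} x \<partial>lborel) = ennreal (pi * a / 2)"
    if a: "a > 0" for a :: real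
  proof -
    have "(\<integral>\<^sup>+x. ennreal ((1 - cos (a * x)) / x\<^sup>2) * indicator {0..} x \<partial>lborel)
      = (\<integral>\<^sup>+x. \<integral>\<^sup>+s. ennreal ((1 - cos (a * x)) * s * exp (- (s * x))) * indicator {0..} s * indicator {0..} x \<partial>lborel \<partial>lborel)"
    proof (rule nn_integral_cong)
      fix x :: real
      show "ennreal ((1 - cos (a * x)) / x\<^sup>2) * indicator {0..} x
        = (\<integral>\<^sup>+s. ennreal ((1 - cos (a * x)) * s * exp (- (s * x))) * indicator {0..} s * indicator {0..} x \<partial>lborel)"
      proof (cases "x > 0")
        case True
        have "(\<integral>\<^sup>+s. ennreal ((1 - cos (a * x)) * s * exp (- (s * x))) * indicator {0..} s * indicator {0..} x \<partial>lborel)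
          = (\<integral>\<^sup>+s. ennreal (1 - cos (a * x)) * (ennreal (s * exp (- (s * x))) * indicator {0..} s) \<partial>lborel)"
          using True
          by (intro nn_integral_cong) (auto simp: indicator_def ennreal_mult[symmetric] mult.assoc)
        also have "\<dots> = ennreal (1 - cos (a * x)) * ennreal (1 / x\<^sup>2)"
          by (subst nn_integral_cmult) (simp_all add: nn_integral_laplace_inverse_square[OF True])
        finally show ?thesis using True by (simp add: ennreal_mult[symmetric])
      qed (cases "x = 0"; simp)
    qed
    also have "\<dots> = (\<integral>\<^sup>+s. \<integral>\<^sup>+x. ennreal ((1 - cos (a * x)) * s * exp (- (s * x))) * indicator {0..} s * indicator {0..} x \<partial>lborel \<partial>lborel)"
      by (rule lborel_pair.Fubini') measurable
    also have "\<dots> = (\<integral>\<^sup>+s. ennreal (a\<^sup>2 / (s\<^sup>2 + a\<^sup>2)) * indicator {0..} s \<partial>lborel)"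
    proof (rule nn_integral_cong_AE)
      show "AE s in lborel. (\<integral>\<^sup>+x. ennreal ((1 - cos (a * x)) * s * exp (- (s * x))) * indicator {0..} s * indicator {0..} x \<partial>lborel)
        = ennreal (a\<^sup>2 / (s\<^sup>2 + a\<^sup>2)) * indicator {0..} s"
        using AE_lborel_singleton[of "0::real"]
      proof eventually_elim
        case (elim s)
        show ?case
        proof (cases "s > 0")
          case True
          have "(\<integral>\<^sup>+x. ennreal ((1 - cos (a * x)) * s * exp (- (s * x))) * indicator {0..} s * indicator {0..} x \<partial>lborel)
            = (\<integral>\<^sup>+x. ennreal s * (ennreal ((1 - cos (a * x)) * exp (- (s * x))) * indicator {0..} x) \<partial>lborel)"
            using True by (intro nn_integral_cong) (auto simp: indicator_def ennreal_mult[symmetric] mult_ac)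
          also have "\<dots> = ennreal s * ennreal (1 / s - s / (s\<^sup>2 + a\<^sup>2))"
            by (subst nn_integral_cmult) (simp_all add: nn_integral_laplace_one_minus_cos[OF True])
          also have "\<dots> = ennreal (s * (1 / s - s / (s\<^sup>2 + a\<^sup>2)))"
            using True by (simp add: ennreal_mult')
          also have "s * (1 / s - s / (s\<^sup>2 + a\<^sup>2)) = a\<^sup>2 / (s\<^sup>2 + a\<^sup>2)"
          proof -
            have "s * (1 / s - s / Q) = (Q - s\<^sup>2) / Q" if "Q > 0" for Q
              using True that by (simp add: divide_simps) (simp add: power2_eq_square algebra_simps)
            from this[of "s\<^sup>2 + a\<^sup>2"] show ?thesis using True by (simp add: add_pos_nonneg)
          qed
          finally show ?thesis using True by simp
        next
          case False
          with elim show ?thesis by simp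
        qed
      qed
    qed
    also have "\<dots> = ennreal (a * (pi / 2) - a * arctan (0 / a))"
    proof (rule nn_integral_FTC_atLeast)
      show "DERIV (\<lambda>s. a * arctan (s / a)) s :> a\<^sup>2 / (s\<^sup>2 + a\<^sup>2)" for s
      proof -
        have "s\<^sup>2 + a\<^sup>2 > 0" using a by (simp add: add_nonneg_pos)
        then show ?thesis using a
          by (auto intro!: derivative_eq_intros simp: field_simps power2_eq_square)
      qed
      show "((\<lambda>s. a * arctan (s / a)) \<longlongrightarrow> a * (pi / 2)) at_top"
        using a by real_asymp
    qed auto
    finally show ?thesis by (simp add: mult.commute)
  qed
  consider "a > 0" | "a = 0" | "a < 0" by linarith
  then show ?thesis
  proof cases
    case 3
    then show ?thesis using pos[of "- a"] by simp
  qed (simp_all add: pos)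
qed

text \<open>
  The Fejer kernel times a cosine is a linear combination of such integrands, and \<open>\<bar>a\<bar>\<close> on the right-hand side is what makes its transform a tent.
\<close>

lemma one_minus_cos_integral:
  fixes a :: real
  shows "has_bochner_integral lborel (\<lambda>x. (1 - cos (a * x)) / x\<^sup>2) (pi * \<bar>a\<bar>)"
proof (rule has_bochner_integral_nn_integral)
  have "(\<integral>\<^sup>+x. ennreal ((1 - cos (a * x)) / x\<^sup>2) \<partial>lborel)
    = (\<integral>\<^sup>+x. ennreal ((1 - cos (a * x)) / x\<^sup>2) * indicator {0..} x + ennreal ((1 - cos (a * x)) / x\<^sup>2) * indicator {..0} x \<partial>lborel)"
    by (intro nn_integral_cong) (auto simp: indicator_def)
  also have "\<dots> = ennreal (pi * \<bar>a\<bar> / 2) + (\<integral>\<^sup>+x. ennreal ((1 - cos (a * x)) / x\<^sup>2) * indicator {..0} x \<partial>lborel)"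
    by (subst nn_integral_add) (simp_all add: nn_integral_one_minus_cos_half)
  also have "(\<integral>\<^sup>+x. ennreal ((1 - cos (a * x)) / x\<^sup>2) * indicator {..0} x \<partial>lborel) = ennreal (pi * \<bar>a\<bar> / 2)"
    by (subst nn_integral_real_affine[of _ "-1" 0])
       (simp_all add: nn_integral_one_minus_cos_half[symmetric] indicator_def)
  finally show "(\<integral>\<^sup>+x. ennreal ((1 - cos (a * x)) / x\<^sup>2) \<partial>lborel) = ennreal (pi * \<bar>a\<bar>)"
    by (simp add: ennreal_plus[symmetric] del: ennreal_plus)
qed auto

text \<open>
  The tent and the Fejer kernel form a Fourier pair with one side compactly supported and the other
  integrable. At the origin the kernel takes the value \<open>0\<close> (division by zero)
  instead of its limit \<open>\<epsilon>\<close>, which changes no integral.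
\<close>

definition tent :: "real \<Rightarrow> real \<Rightarrow> real" where
  "tent \<epsilon> y = max 0 (1 - \<bar>y\<bar> / \<epsilon>)"

definition fejer :: "real \<Rightarrow> real \<Rightarrow> real" where
  "fejer \<epsilon> x = (sin (pi * \<epsilon> * x))\<^sup>2 / (pi\<^sup>2 * \<epsilon> * x\<^sup>2)"

lemma fejer_nonneg: "\<epsilon> > 0 \<Longrightarrow> 0 \<le> fejer \<epsilon> x"
  by (simp add: fejer_def)

lemma fejer_le: "\<epsilon> > 0 \<Longrightarrow> fejer \<epsilon> x \<le> \<epsilon>"
proof (cases "x = 0")
  case False
  assume "\<epsilon> > 0"
  have "(sin (pi * \<epsilon> * x))\<^sup>2 \<le> (pi * \<epsilon> * x)\<^sup>2"
    using abs_sin_x_le_abs_x[of "pi * \<epsilon> * x"] by (simp add: abs_le_square_iff)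
  then have "fejer \<epsilon> x \<le> (pi * \<epsilon> * x)\<^sup>2 / (pi\<^sup>2 * \<epsilon> * x\<^sup>2)"
    unfolding fejer_def using \<open>\<epsilon> > 0\<close> by (intro divide_right_mono) auto
  then show ?thesis using \<open>\<epsilon> > 0\<close> False
    by (simp add: power2_eq_square)
qed (simp add: fejer_def)

lemma borel_measurable_fejer [measurable]: "fejer \<epsilon> \<in> borel_measurable borel"
  unfolding fejer_def by measurable

lemma borel_measurable_tent [measurable]: "tent \<epsilon> \<in> borel_measurable borel"
  unfolding tent_def by measurable

lemma tent_nonneg: "0 \<le> tent \<epsilon> y" and tent_le_1: "\<epsilon> > 0 \<Longrightarrow> tent \<epsilon> y \<le> 1"
  by (auto simp: tent_def)

lemma tent_eq_0: "\<epsilon> > 0 \<Longrightarrow> \<bar>y\<bar> \<ge> \<epsilon> \<Longrightarrow> tent \<epsilon> y = 0"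
  by (simp add: tent_def)

lemma fejer_cos_integral:
  assumes "\<epsilon> > 0"
  shows "has_bochner_integral lborel (\<lambda>x. fejer \<epsilon> x * cos (2 * pi * (y * x))) (tent \<epsilon> y)"
proof -
  let ?f = "\<lambda>c x :: real. (1 - cos (c * x)) / x\<^sup>2"
  have "has_bochner_integral lborel
      (\<lambda>x. (?f (2 * pi * (\<epsilon> + y)) x / 2 + ?f (2 * pi * (\<epsilon> - y)) x / 2 - ?f (2 * pi * y) x) * (1 / (2 * pi\<^sup>2 * \<epsilon>)))
      ((pi * \<bar>2 * pi * (\<epsilon> + y)\<bar> / 2 + pi * \<bar>2 * pi * (\<epsilon> - y)\<bar> / 2 - pi * \<bar>2 * pi * y\<bar>) * (1 / (2 * pi\<^sup>2 * \<epsilon>)))"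
    by (intro has_bochner_integral_mult_left has_bochner_integral_add has_bochner_integral_diff
        has_bochner_integral_divide_zero one_minus_cos_integral)
  moreover have "(?f (2 * pi * (\<epsilon> + y)) x / 2 + ?f (2 * pi * (\<epsilon> - y)) x / 2 - ?f (2 * pi * y) x) * (1 / (2 * pi\<^sup>2 * \<epsilon>))
     = fejer \<epsilon> x * cos (2 * pi * (y * x))" for x
  proof -
    define A where "A = pi * \<epsilon> * x"
    define Y where "Y = 2 * pi * (y * x)"
    have s: "(sin A)\<^sup>2 = (1 - cos (2 * A)) / 2"
      by (simp add: cos_double sin_squared_eq)
    have *: "2 * pi * (\<epsilon> + y) * x = 2 * A + Y" "2 * pi * (\<epsilon> - y) * x = 2 * A - Y" "2 * pi * y * x = Y"
      by (simp_all add: A_def Y_def algebra_simps)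
    have "(?f (2 * pi * (\<epsilon> + y)) x / 2 + ?f (2 * pi * (\<epsilon> - y)) x / 2 - ?f (2 * pi * y) x)
       = ((1 - cos (2 * A + Y)) / 2 + (1 - cos (2 * A - Y)) / 2 - (1 - cos Y)) / x\<^sup>2"
      unfolding * by (simp add: add_divide_distrib diff_divide_distrib)
    also have "(1 - cos (2 * A + Y)) / 2 + (1 - cos (2 * A - Y)) / 2 - (1 - cos Y) = (1 - cos (2 * A)) * cos Y"
      by (simp add: cos_add cos_diff field_simps)
    also have "\<dots> = 2 * (sin A)\<^sup>2 * cos Y" by (simp add: s)
    finally have X: "?f (2 * pi * (\<epsilon> + y)) x / 2 + ?f (2 * pi * (\<epsilon> - y)) x / 2 - ?f (2 * pi * y) x
      = 2 * (sin A)\<^sup>2 * cos Y / x\<^sup>2" .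
    show ?thesis
      unfolding X fejer_def A_def[symmetric] Y_def[symmetric] by simp
  qed
  moreover have "(pi * \<bar>2 * pi * (\<epsilon> + y)\<bar> / 2 + pi * \<bar>2 * pi * (\<epsilon> - y)\<bar> / 2 - pi * \<bar>2 * pi * y\<bar>) * (1 / (2 * pi\<^sup>2 * \<epsilon>))
     = tent \<epsilon> y"
  proof -
    have "(pi * \<bar>2 * pi * (\<epsilon> + y)\<bar> / 2 + pi * \<bar>2 * pi * (\<epsilon> - y)\<bar> / 2 - pi * \<bar>2 * pi * y\<bar>) * (1 / (2 * pi\<^sup>2 * \<epsilon>))
       = (\<bar>\<epsilon> + y\<bar> / 2 + \<bar>\<epsilon> - y\<bar> / 2 - \<bar>y\<bar>) / \<epsilon>"
    proof -
      have "(pi * (2 * pi * u) / 2 + pi * (2 * pi * v) / 2 - pi * (2 * pi * w)) * (1 / (2 * pi\<^sup>2 * \<epsilon>))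
        = (u / 2 + v / 2 - w) / \<epsilon>" for u v w :: real
        using assms by (simp add: divide_simps) (simp add: power2_eq_square algebra_simps)
      from this[of "\<bar>\<epsilon> + y\<bar>" "\<bar>\<epsilon> - y\<bar>" "\<bar>y\<bar>"] show ?thesis by (simp only: abs_mult abs_numeral abs_of_pos[OF pi_gt_zero])
    qed
    also have "\<bar>\<epsilon> + y\<bar> / 2 + \<bar>\<epsilon> - y\<bar> / 2 - \<bar>y\<bar> = max 0 (\<epsilon> - \<bar>y\<bar>)"
      using assms by (auto simp: max_def abs_if add_divide_distrib diff_divide_distrib)
    also have "max 0 (\<epsilon> - \<bar>y\<bar>) / \<epsilon> = tent \<epsilon> y"
      using assms by (simp add: tent_def max_def field_simps)
    finally show ?thesis .
  qed
  ultimately show ?thesis by (simp only:)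
qed

lemma integrable_fejer: "\<epsilon> > 0 \<Longrightarrow> integrable lborel (fejer \<epsilon>)"
  using fejer_cos_integral[of \<epsilon> 0] by (simp add: has_bochner_integral_iff)

lemma integrable_fejer_ee:
  assumes "\<epsilon> > 0"
  shows "integrable lborel (\<lambda>x. of_real (fejer \<epsilon> x) * ee (y * x))"
  by (rule Bochner_Integration.integrable_bound[OF integrable_fejer[OF assms]])
     (auto simp: norm_mult fejer_nonneg[OF assms])

text \<open>The transform is real since the kernel is even.\<close>

lemma fejer_transform:
  assumes "\<epsilon> > 0"
  shows "(\<integral>x. of_real (fejer \<epsilon> x) * ee (y * x) \<partial>lborel) = of_real (tent \<epsilon> y)"
proof -
  let ?I = "\<lambda>y. \<integral>x. of_real (fejer \<epsilon> x) * ee (y * x) \<partial>lborel"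
  have "?I y = ?I (- y)"
    by (subst lborel_integral_real_affine[of "-1" _ 0]) (simp_all add: fejer_def)
  then have "?I y = (?I y + ?I (- y)) / 2" by simp
  also have "\<dots> = (\<integral>x. (of_real (fejer \<epsilon> x) * ee (y * x) + of_real (fejer \<epsilon> x) * ee (- y * x)) / 2 \<partial>lborel)"
    using integrable_fejer_ee[OF assms, of y] integrable_fejer_ee[OF assms, of "- y"] by simp
  also have "\<dots> = (\<integral>x. complex_of_real (fejer \<epsilon> x * cos (2 * pi * (y * x))) \<partial>lborel)"
    by (intro Bochner_Integration.integral_cong) (simp_all add: cos_eq_ee distrib_left del: of_real_mult add: of_real_mult[of "fejer _ _"])
  also have "\<dots> = of_real (tent \<epsilon> y)"
    using fejer_cos_integral[OF assms, of y] by (simp add: has_bochner_integral_iff del: of_real_mult)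
  finally show ?thesis .
qed

text \<open>
  The primitive of \<open>1 - x / \<epsilon>\<close> gives the half \<open>[0, \<epsilon>]\<close>; the other half is its reflection, and the two
  overlap in a null set only.
\<close>

lemma tent_integral:
  assumes "\<epsilon> > 0"
  shows "has_bochner_integral lborel (tent \<epsilon>) \<epsilon>"
proof -
  have R: "has_bochner_integral lborel (\<lambda>x. indicator {0..\<epsilon>} x *\<^sub>R (1 - x / \<epsilon>)) (\<epsilon> / 2)"
  proof -
    have c: "continuous_on {0..\<epsilon>} (\<lambda>x. 1 - x / \<epsilon>)" by (intro continuous_intros) (use assms in auto)
    have "(\<integral>x. indicator {0..\<epsilon>} x *\<^sub>R (1 - x / \<epsilon>) \<partial>lborel) = (\<epsilon> - \<epsilon>\<^sup>2 / (2 * \<epsilon>)) - (0 - 0\<^sup>2 / (2 * \<epsilon>))"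
      by (rule integral_FTC_atLeastAtMost[where F = "\<lambda>x. x - x\<^sup>2 / (2 * \<epsilon>)"])
         (use assms c in \<open>auto simp flip: has_real_derivative_iff_has_vector_derivative intro!: derivative_eq_intros\<close>)
    then show ?thesis
      using borel_integrable_atLeastAtMost'[OF c] assms
      by (simp add: has_bochner_integral_iff set_integrable_def power2_eq_square)
  qed
  have L: "has_bochner_integral lborel (\<lambda>x. indicator {0..\<epsilon>} (- x) *\<^sub>R (1 - (- x) / \<epsilon>)) (\<epsilon> / 2)"
    using R lborel_integrable_real_affine[of "\<lambda>x. indicator {0..\<epsilon>} x *\<^sub>R (1 - x / \<epsilon>)" "-1" 0]
      lborel_integral_real_affine[of "-1" "\<lambda>x. indicator {0..\<epsilon>} x *\<^sub>R (1 - x / \<epsilon>)" 0]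
    by (simp add: has_bochner_integral_iff)
  have "has_bochner_integral lborel (tent \<epsilon>) (\<epsilon> / 2 + \<epsilon> / 2)"
  proof (rule has_bochner_integralI_AE[OF has_bochner_integral_add[OF R L]])
    show "AE x in lborel. indicator {0..\<epsilon>} x *\<^sub>R (1 - x / \<epsilon>) + indicator {0..\<epsilon>} (- x) *\<^sub>R (1 - - x / \<epsilon>) = tent \<epsilon> x"
      using AE_lborel_singleton[of "0::real"]
      by eventually_elim (use assms in \<open>auto simp: tent_def indicator_def max_def field_simps\<close>)
  qed measurable
  then show ?thesis by simp
qed

section \<open>Frequencies without resonances\<close>

text \<open>
  Uniqueness of expansions in base \<open>B\<close> with signed digits, with the digits stored as the coefficients of a
  polynomial: the lowest digit is divisible by \<open>B\<close>, hence zero, and one divides by \<open>B\<close>.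
\<close>

lemma poly_zero_if_small_coeffs:
  fixes p :: "int poly"
  assumes "poly p B = 0" and "\<And>i. \<bar>coeff p i\<bar> < B"
  shows "p = 0"
  using assms
proof (induction p)
  case (pCons a q)
  have "a + B * poly q B = 0" using pCons.prems(1) by simp
  then have "B dvd a" by (metis add.commute dvd_triv_left dvd_minus_iff minus_unique)
  moreover have "\<bar>a\<bar> < B" using pCons.prems(2)[of 0] by simp
  ultimately have "a = 0" by (metis abs_ge_zero dvd_imp_le_int linorder_not_less order.strict_trans1 abs_of_pos)
  moreover have "B \<noteq> 0" using pCons.prems(2)[of 0] by auto
  ultimately have "poly q B = 0" using pCons.prems(1) by simp
  moreover have "\<bar>coeff q i\<bar> < B" for i using pCons.prems(2)[of "Suc i"] by simp
  ultimately show ?case using pCons.IH \<open>a = 0\<close> by simp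
qed simp

definition label :: "'d::finite \<Rightarrow> nat" where
  "label = (SOME h. bij_betw h UNIV {0..<CARD('d)})"

text \<open>
  Interleaving the coordinates makes the exponents distinct for all pairs of an index and a coordinate, so that different
  coordinates cannot conspire. The base exceeds the largest digit \<open>1 + 2 * CARD('d)\<close> that occurs in
  \<open>frequencies_nonresonant\<close>.
\<close>

definition expo :: "nat \<times> 'd::finite \<Rightarrow> nat" where
  "expo p = fst p * CARD('d) + label (snd p)"

definition freq :: "nat \<times> 'd::finite \<Rightarrow> int" where
  "freq p = (2 * int CARD('d) + 2) ^ expo p"

lemma bij_label: "bij_betw (label :: 'd::finite \<Rightarrow> nat) UNIV {0..<CARD('d)}"
  unfolding label_def using ex_bij_betw_finite_nat[OF finite_class.finite_UNIV] by (rule someI_ex)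

lemma label_less: "label (j :: 'd::finite) < CARD('d)"
  using bij_label[where 'd='d] by (auto simp: bij_betw_def)

lemma label_eq_iff: "label (j :: 'd::finite) = label k \<longleftrightarrow> j = k"
  using bij_label[where 'd='d] by (auto simp: bij_betw_def inj_on_def)

lemma expo_eq_iff: "expo (p :: nat \<times> 'd::finite) = expo q \<longleftrightarrow> p = q"
proof
  assume eq: "expo p = expo q"
  have "expo p div CARD('d) = fst p" "expo p mod CARD('d) = label (snd p)" for p :: "nat \<times> 'd"
    using label_less[of "snd p"] by (simp_all add: expo_def)
  with eq show "p = q" by (metis label_eq_iff prod_eqI)
qed simp

lemma freq_pos: "freq p > 0"
  by (simp add: freq_def)

lemma freq_eq_iff: "freq (p :: nat \<times> 'd::finite) = freq q \<longleftrightarrow> p = q"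
  unfolding freq_def by (subst power_inject_exp) (simp_all add: expo_eq_iff)

definition node :: "('d::finite \<Rightarrow> nat) \<Rightarrow> real ^ 'd" where
  "node \<sigma> = (\<chi> j. of_int (freq (\<sigma> j, j)))"

text \<open>
  Every term of the sum is \<open>c * B ^ (2 * e) - 2 * c * B ^ s\<close>. As the exponents \<open>e\<close> are distinct, at most one
  term of the first kind contributes to a given digit, and at most \<open>CARD('d)\<close> terms of the second kind do, one
  per coordinate. So there are no carries, and every digit of a vanishing sum is zero. But the digit at
  \<open>2 * e\<close> has the parity of \<open>c\<close>, which is odd unless \<open>c\<close> is zero.
\<close>

lemma frequencies_nonresonant:
  fixes c :: "nat \<times> 'd::finite \<Rightarrow> int" and \<sigma> :: "'d \<Rightarrow> nat"
  assumes P: "finite P" and c: "\<And>p. p \<in> P \<Longrightarrow> \<bar>c p\<bar> \<le> 1" and p0: "p0 \<in> P" "c p0 \<noteq> 0"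
  shows "(\<Sum>p\<in>P. c p * ((freq p)\<^sup>2 - 2 * freq p * freq (\<sigma> (snd p), snd p))) \<noteq> 0"
proof
  define B where "B = 2 * int CARD('d) + 2"
  define s where "s p = expo p + expo (\<sigma> (snd p), snd p)" for p :: "nat \<times> 'd"
  define Q where "Q = (\<Sum>p\<in>P. monom (c p) (2 * expo p) - monom (2 * c p) (s p))"
  assume "(\<Sum>p\<in>P. c p * ((freq p)\<^sup>2 - 2 * freq p * freq (\<sigma> (snd p), snd p))) = 0"
  also have "(\<Sum>p\<in>P. c p * ((freq p)\<^sup>2 - 2 * freq p * freq (\<sigma> (snd p), snd p))) = poly Q B"
    by (auto simp: Q_def poly_sum poly_monom s_def freq_def B_def[symmetric] power_add power_even_eq
        right_diff_distrib intro!: sum.cong)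
  finally have root: "poly Q B = 0" .
  have coeff: "coeff Q i = (\<Sum>p\<in>{p\<in>P. 2 * expo p = i}. c p) - 2 * (\<Sum>p\<in>{p\<in>P. s p = i}. c p)" for i
    using P by (simp add: Q_def coeff_sum sum_subtractf sum.inter_filter sum_distrib_left if_distrib cong: if_cong)
  have "\<bar>coeff Q i\<bar> < B" for i
  proof -
    have sum_le: "\<bar>sum c A\<bar> \<le> int (card A)" if "A \<subseteq> P" for A
    proof -
      have "\<bar>sum c A\<bar> \<le> (\<Sum>p\<in>A. \<bar>c p\<bar>)" by (rule sum_abs)
      also have "\<dots> \<le> (\<Sum>p\<in>A. 1)" using that by (intro sum_mono c) auto
      finally show ?thesis by simp
    qed
    have fin: "finite {p\<in>P. R p}" for R using P by simp
    have "\<bar>\<Sum>p\<in>{p\<in>P. 2 * expo p = i}. c p\<bar> \<le> int (card {p\<in>P. 2 * expo p = i})"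
      by (rule sum_le) auto
    also have "card {p\<in>P. 2 * expo p = i} \<le> 1"
      using fin by (subst card_le_Suc0_iff_eq[unfolded One_nat_def[symmetric]]) (auto simp: expo_eq_iff[symmetric])
    finally have A: "\<bar>\<Sum>p\<in>{p\<in>P. 2 * expo p = i}. c p\<bar> \<le> 1" by simp
    have "\<bar>\<Sum>p\<in>{p\<in>P. s p = i}. c p\<bar> \<le> int (card {p\<in>P. s p = i})"
      by (rule sum_le) auto
    \<comment> \<open>Given its coordinate, the sum of the two exponents determines the index.\<close>
    also have "card {p\<in>P. s p = i} \<le> CARD('d)"
    proof (rule card_inj_on_le[where f = snd])
      show "inj_on snd {p\<in>P. s p = i}"
        by (rule inj_onI) (auto simp: s_def expo_def label_eq_iff)
    qed auto
    finally have "\<bar>\<Sum>p\<in>{p\<in>P. s p = i}. c p\<bar> \<le> int CARD('d)" by simp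
    with A show ?thesis unfolding coeff B_def by linarith
  qed
  with root have "Q = 0" by (rule poly_zero_if_small_coeffs)
  then have "(\<Sum>p\<in>{p\<in>P. 2 * expo p = 2 * expo p0}. c p) = 2 * (\<Sum>p\<in>{p\<in>P. s p = 2 * expo p0}. c p)"
    using coeff[of "2 * expo p0"] by simp
  moreover have "{p\<in>P. 2 * expo p = 2 * expo p0} = {p0}"
    using p0 by (auto simp: expo_eq_iff)
  ultimately have "even (c p0)" by simp
  with c[OF p0(1)] p0(2) show False by (auto simp: abs_le_iff elim!: evenE)
qed

section \<open>Means of trigonometric polynomials\<close>

text \<open>
  Over a box of even integer side lengths and unit time, all characters except the constant one
  integrate to zero. The nonnegativity of \<open>F\<close> links the extended and the Bochner integral.
\<close>

lemma trig_mean: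
  fixes F :: "real ^ 'd \<Rightarrow> real \<Rightarrow> real" and M :: "'q \<Rightarrow> 'd \<Rightarrow> int" and Z :: "'q \<Rightarrow> int"
  assumes fin: "finite Q" and nonneg: "\<And>x t. 0 \<le> F x t"
    and F: "\<And>x t. complex_of_real (F x t) =
      (\<Sum>q\<in>Q. of_real (A q) * ee ((\<Sum>j\<in>UNIV. of_int (M q j) * x $ j) + of_int (Z q) * t))"
  shows "(\<integral>\<^sup>+t\<in>{0..1}. (\<integral>\<^sup>+x. ennreal (F x t) * indicator (cbox (\<chi> j. - real R) (\<chi> j. real R)) x \<partial>lborel) \<partial>lborel)
    = ennreal ((2 * real R) ^ CARD('d) * (\<Sum>q | q \<in> Q \<and> (\<forall>j. M q j = 0) \<and> Z q = 0. A q))"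
proof -
  let ?B = "cbox (\<chi> j. - real R) (\<chi> j. real R) :: (real ^ 'd) set"
  let ?g = "\<lambda>q j y. indicator {- real R..real R} y *\<^sub>R ee (of_int (M q j) * y)"
  define V where "V = (2 * real R) ^ CARD('d)"
  have box: "indicator ?B x = (\<Prod>j\<in>UNIV. indicator {- real R..real R} (x $ j) :: real)" for x
    by (auto simp: indicator_def mem_box_cart)
  have split: "complex_of_real (F x t * indicator ?B x) =
      (\<Sum>q\<in>Q. of_real (A q) * ee (of_int (Z q) * t) * (\<Prod>j\<in>UNIV. ?g q j (x $ j)))" for x t
    by (simp add: F box ee_add ee_sum sum_distrib_left sum_distrib_right prod.distrib scaleR_conv_of_real mult_ac)
  have int_g: "integrable lborel (\<lambda>x. \<Prod>j\<in>UNIV. ?g q j ((x :: real ^ 'd) $ j))" for q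
    by (rule lborel_prod_vec(1)) (rule integrable_ee_interval)
  have "(\<integral>x. (\<Prod>j\<in>UNIV. ?g q j ((x :: real ^ 'd) $ j)) \<partial>lborel) = (\<Prod>j\<in>(UNIV::'d set). if M q j = 0 then 2 * of_nat R else 0)" for q
    by (subst lborel_prod_vec(2)) (auto simp: integrable_ee_interval integral_ee_interval[where p = "2 * int R"] intro!: prod.cong)
  also have "(\<Prod>j\<in>(UNIV::'d set). if M q j = 0 then 2 * of_nat R else 0) = (if \<forall>j. M q j = 0 then complex_of_real V else 0)" for q
    by (auto simp: V_def)
  finally have val_g: "(\<integral>x. (\<Prod>j\<in>UNIV. ?g q j ((x :: real ^ 'd) $ j)) \<partial>lborel) = (if \<forall>j. M q j = 0 then complex_of_real V else 0)" for q .
  define G where "G t = (\<integral>x. F x t * indicator ?B x \<partial>lborel)" for t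
  have int_F: "integrable lborel (\<lambda>x. F x t * indicator ?B x)" for t
    unfolding complex_of_real_integrable_eq[symmetric] split
    by (intro Bochner_Integration.integrable_sum integrable_mult_right int_g)
  have G: "complex_of_real (G t) = (\<Sum>q | q \<in> Q \<and> (\<forall>j. M q j = 0). of_real (A q * V) * ee (of_int (Z q) * t))" for t
  proof -
    have "complex_of_real (G t) = (\<integral>x. complex_of_real (F x t * indicator ?B x) \<partial>lborel)"
      unfolding G_def by (rule integral_complex_of_real[symmetric])
    also have "\<dots> = (\<Sum>q\<in>Q. of_real (A q) * ee (of_int (Z q) * t) * (if \<forall>j. M q j = 0 then complex_of_real V else 0))"
      unfolding split by (subst Bochner_Integration.integral_sum) (simp_all add: int_g val_g)
    finally show ?thesis using fin by (simp add: sum.inter_filter mult_ac if_distrib cong: if_cong)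
  qed
  have G_nonneg: "0 \<le> G t" for t
    unfolding G_def by (intro integral_nonneg_AE) (simp add: nonneg)
  have inner: "(\<integral>\<^sup>+x. ennreal (F x t) * indicator ?B x \<partial>lborel) = ennreal (G t)" for t
  proof -
    have "(\<integral>\<^sup>+x. ennreal (F x t) * indicator ?B x \<partial>lborel) = (\<integral>\<^sup>+x. ennreal (F x t * indicator ?B x) \<partial>lborel)"
      by (intro nn_integral_cong) (simp add: indicator_def)
    then show ?thesis
      unfolding G_def using int_F by (simp add: nn_integral_eq_integral nonneg)
  qed
  let ?Q = "{q. q \<in> Q \<and> (\<forall>j. M q j = 0)}"
  have split_t: "complex_of_real (G t * indicator {0..1} t)
      = (\<Sum>q\<in>?Q. of_real (A q * V) * (indicator {0..1} t *\<^sub>R ee (of_int (Z q) * t)))" for t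
    unfolding of_real_mult G sum_distrib_right
    by (intro sum.cong) (simp_all add: scaleR_conv_of_real mult_ac)
  have int_G: "integrable lborel (\<lambda>t. G t * indicator {0..1} t)"
    unfolding complex_of_real_integrable_eq[symmetric] split_t
    by (intro Bochner_Integration.integrable_sum integrable_mult_right integrable_ee_interval)
  have "complex_of_real (\<integral>t. G t * indicator {0..1} t \<partial>lborel) = (\<integral>t. complex_of_real (G t * indicator {0..1} t) \<partial>lborel)"
    by (rule integral_complex_of_real[symmetric])
  also have "\<dots> = (\<Sum>q\<in>?Q. of_real (A q * V) * (if Z q = 0 then 1 else 0))"
    unfolding split_t by (subst Bochner_Integration.integral_sum)
      (simp_all add: integrable_ee_interval integral_ee_interval[where p = 1] del: mult_scaleR_right, intro sum.cong, auto)
  also have "\<dots> = complex_of_real (V * (\<Sum>q | q \<in> Q \<and> (\<forall>j. M q j = 0) \<and> Z q = 0. A q))"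
  proof -
    have "(\<Sum>q\<in>?Q. complex_of_real (A q * V) * (if Z q = 0 then 1 else 0))
      = (\<Sum>q\<in>?Q. if Z q = 0 then complex_of_real (A q * V) else 0)"
      by (intro sum.cong) auto
    also have "\<dots> = (\<Sum>q\<in>{q \<in> ?Q. Z q = 0}. complex_of_real (A q * V))"
      using fin by (intro sum.inter_filter[symmetric]) simp
    also have "{q \<in> ?Q. Z q = 0} = {q \<in> Q. (\<forall>j. M q j = 0) \<and> Z q = 0}" by auto
    finally show ?thesis by (simp add: sum_distrib_left mult.commute)
  qed
  finally have val: "(\<integral>t. G t * indicator {0..1} t \<partial>lborel) = V * (\<Sum>q | q \<in> Q \<and> (\<forall>j. M q j = 0) \<and> Z q = 0. A q)"
    by (simp only: of_real_eq_iff)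
  have "(\<integral>\<^sup>+t\<in>{0..1}. ennreal (G t) \<partial>lborel) = (\<integral>\<^sup>+t. ennreal (G t * indicator {0..1} t) \<partial>lborel)"
    by (intro nn_integral_cong) (simp add: indicator_def)
  also have "\<dots> = ennreal (\<integral>t. G t * indicator {0..1} t \<partial>lborel)"
    using int_G by (intro nn_integral_eq_integral) (simp_all add: G_nonneg)
  finally show ?thesis unfolding inner val V_def .
qed

section \<open>The Riesz product and the exponential sum\<close>

definition modes :: "nat \<Rightarrow> (nat \<times> 'd::finite) set" where
  "modes L = {..<L} \<times> UNIV"

definition angle :: "nat \<times> 'd::finite \<Rightarrow> real ^ 'd \<Rightarrow> real \<Rightarrow> real" where
  "angle p x t = of_int (freq p) * x $ snd p + (of_int (freq p))\<^sup>2 * t"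

definition riesz :: "nat \<Rightarrow> real ^ 'd::finite \<Rightarrow> real \<Rightarrow> real" where
  "riesz L x t = (\<Prod>p\<in>modes L. 1 + cos (2 * pi * angle p x t))"

text \<open>
  Choosing in every factor \<open>1 + (e(\<theta>) + e(- \<theta>)) / 2\<close> one of the three terms expands the Riesz product: \<open>signs\<close> are
  the choices, \<open>amp\<close> is the resulting coefficient. Positivity of these coefficients is essential.
\<close>

definition signs :: "nat \<Rightarrow> (nat \<times> 'd::finite \<Rightarrow> int) set" where
  "signs L = PiE (modes L) (\<lambda>_. {-1, 0, 1})"

definition amp :: "nat \<Rightarrow> (nat \<times> 'd::finite \<Rightarrow> int) \<Rightarrow> real" where
  "amp L c = (\<Prod>p\<in>modes L. if c p = 0 then 1 else 1 / 2)"

lemma finite_modes [simp]: "finite (modes L)"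
  by (simp add: modes_def)

lemma card_modes: "card (modes L :: (nat \<times> 'd::finite) set) = L * CARD('d)"
  by (simp add: modes_def card_cartesian_product)

lemma finite_signs [simp]: "finite (signs L)"
  by (simp add: signs_def finite_PiE)

lemma signs_abs_le: "c \<in> signs L \<Longrightarrow> p \<in> modes L \<Longrightarrow> \<bar>c p\<bar> \<le> 1"
  by (auto simp: signs_def dest!: PiE_mem)

lemma amp_pos: "0 < amp L c"
  by (auto simp: amp_def intro!: prod_pos)

lemma sum_amp: "(\<Sum>c\<in>signs L. amp L (c :: nat \<times> 'd::finite \<Rightarrow> int)) = 2 ^ (L * CARD('d))"
proof -
  have "(\<Sum>c\<in>signs L. amp L (c :: nat \<times> 'd \<Rightarrow> int))
      = (\<Prod>p\<in>(modes L :: (nat \<times> 'd) set). \<Sum>a\<in>{-1, 0, 1::int}. if a = 0 then 1 else 1 / 2)"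
    unfolding signs_def amp_def by (subst prod_sum_PiE) auto
  then show ?thesis by (simp add: card_modes)
qed

lemma riesz_expansion:
  "complex_of_real (riesz L x t) = (\<Sum>c\<in>signs L. of_real (amp L c) * ee (\<Sum>p\<in>modes L. of_int (c p) * angle p x t))"
proof -
  have "complex_of_real (riesz L x t)
     = (\<Prod>p\<in>modes L. \<Sum>a\<in>{-1, 0, 1::int}. of_real (if a = 0 then 1 else 1 / 2) * ee (of_int a * angle p x t))"
    unfolding riesz_def of_real_prod
    by (intro prod.cong) (simp_all add: cos_eq_ee add_divide_distrib)
  also have "\<dots> = (\<Sum>c\<in>signs L. \<Prod>p\<in>modes L. of_real (if c p = 0 then 1 else 1 / 2) * ee (of_int (c p) * angle p x t))"
    unfolding signs_def by (subst prod_sum_PiE) auto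
  finally show ?thesis
    by (simp add: amp_def prod.distrib ee_sum)
qed

lemma riesz_nonneg: "0 \<le> riesz L x t"
  unfolding riesz_def by (intro prod_nonneg ballI) (smt (verit) cos_ge_minus_one)

lemma riesz_le: "riesz L (x :: real ^ 'd::finite) t \<le> 2 ^ (L * CARD('d))"
proof -
  have "riesz L x t \<le> (\<Prod>p\<in>(modes L :: (nat \<times> 'd) set). 2)"
    unfolding riesz_def by (intro prod_mono) (smt (verit) cos_ge_minus_one cos_le_one)
  then show ?thesis by (simp add: card_modes)
qed

lemma borel_measurable_riesz [measurable (raw)]:
  assumes "f \<in> borel_measurable M" "g \<in> borel_measurable M"
  shows "(\<lambda>z. riesz L (f z) (g z)) \<in> borel_measurable M"
proof -
  have [measurable]: "(\<lambda>z. f z $ j) \<in> borel_measurable M" for j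
    using assms(1) by (rule measurable_compose) (intro borel_measurable_continuous_onI continuous_intros)
  note assms[measurable]
  show ?thesis unfolding riesz_def angle_def by measurable
qed

text \<open>
  The constant is crude, but it does not depend on the width of the tents, which is chosen last.
\<close>

lemma riesz_lipschitz:
  fixes x y :: "real ^ 'd::finite"
  assumes "\<And>j. \<bar>x $ j - y $ j\<bar> \<le> \<delta>"
  shows "\<bar>riesz L x t - riesz L y t\<bar> \<le> 2 ^ (L * CARD('d)) * (2 * pi * (\<delta> * (\<Sum>p\<in>(modes L :: (nat \<times> 'd) set). of_int (freq p))))"
proof -
  let ?S = "\<Sum>p\<in>(modes L :: (nat \<times> 'd) set). real_of_int (freq p)"
  let ?e = "\<lambda>c x. ee (\<Sum>p\<in>modes L. of_int (c p) * angle p x t)"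
  have diff: "cmod (?e c x - ?e c y) \<le> 2 * pi * (\<delta> * ?S)" if "c \<in> signs L" for c
  proof -
    have "\<bar>(\<Sum>p\<in>modes L. of_int (c p) * angle p x t) - (\<Sum>p\<in>modes L. of_int (c p) * angle p y t)\<bar>
      = \<bar>\<Sum>p\<in>modes L. of_int (c p) * (of_int (freq p) * (x $ snd p - y $ snd p))\<bar>"
      by (simp add: sum_subtractf[symmetric] angle_def algebra_simps)
    also have "\<dots> \<le> (\<Sum>p\<in>modes L. \<bar>of_int (c p) * (of_int (freq p) * (x $ snd p - y $ snd p))\<bar>)"
      by (rule sum_abs)
    also have "\<dots> \<le> (\<Sum>p\<in>(modes L :: (nat \<times> 'd) set). 1 * (of_int (freq p) * \<delta>))"
    proof (intro sum_mono)
      fix p :: "nat \<times> 'd" assume p: "p \<in> modes L"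
      have "\<bar>real_of_int (c p)\<bar> \<le> 1" using signs_abs_le[OF that p] by linarith
      moreover have "\<bar>of_int (freq p) * (x $ snd p - y $ snd p)\<bar> \<le> of_int (freq p) * \<delta>"
        using assms freq_pos[of p] by (simp add: abs_mult)
      ultimately show "\<bar>of_int (c p) * (of_int (freq p) * (x $ snd p - y $ snd p))\<bar> \<le> 1 * (of_int (freq p) * \<delta>)"
        unfolding abs_mult[of "of_int (c p)"] by (intro mult_mono) auto
    qed
    also have "\<dots> = \<delta> * ?S" by (simp add: sum_distrib_left mult.commute)
    finally show ?thesis
      by (intro order_trans[OF norm_ee_diff_le] mult_left_mono) auto
  qed
  have "\<bar>riesz L x t - riesz L y t\<bar> = cmod (complex_of_real (riesz L x t) - complex_of_real (riesz L y t))"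
    by (metis norm_of_real of_real_diff)
  also have "\<dots> = cmod (\<Sum>c\<in>signs L. of_real (amp L c) * (?e c x - ?e c y))"
    unfolding riesz_expansion by (simp add: sum_subtractf right_diff_distrib)
  also have "\<dots> \<le> (\<Sum>c\<in>(signs L :: (nat \<times> 'd \<Rightarrow> int) set). amp L c * (2 * pi * (\<delta> * ?S)))"
    by (rule sum_norm_le) (simp add: norm_mult diff amp_pos less_imp_le abs_of_pos mult_left_mono)
  also have "\<dots> = 2 ^ (L * CARD('d)) * (2 * pi * (\<delta> * ?S))"
    by (simp add: sum_distrib_right[symmetric] sum_amp)
  finally show ?thesis .
qed

text \<open>
  Along such a line the signed sum \<open>c\<close> contributes a character in \<open>t\<close> of integer frequency, which by
  \<open>frequencies_nonresonant\<close> vanishes only for \<open>c = 0\<close>.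
\<close>

lemma riesz_line_mean:
  fixes x :: "real ^ 'd::finite"
  shows "(\<integral>t. indicator {0..1} t * riesz L (x - (2 * t) *\<^sub>R node \<sigma>) t \<partial>lborel) = 1"
proof -
  define Z where "Z c = (\<Sum>p\<in>modes L. c p * ((freq p)\<^sup>2 - 2 * freq p * freq (\<sigma> (snd p), snd p)))" for c
  define K where "K c = (\<Sum>p\<in>modes L. of_int (c p) * (of_int (freq p) * x $ snd p))" for c
  have phase: "(\<Sum>p\<in>modes L. of_int (c p) * angle p (x - (2 * t) *\<^sub>R node \<sigma>) t) = K c + of_int (Z c) * t" for c t
    unfolding K_def Z_def of_int_sum sum_distrib_right sum.distrib[symmetric]
    by (intro sum.cong) (simp_all add: angle_def node_def algebra_simps)
  have split: "complex_of_real (indicator {0..1} t * riesz L (x - (2 * t) *\<^sub>R node \<sigma>) t)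
    = (\<Sum>c\<in>signs L. (of_real (amp L c) * ee (K c)) * (indicator {0..1} t *\<^sub>R ee (of_int (Z c) * t)))" for t
    unfolding of_real_mult riesz_expansion phase sum_distrib_left
    by (intro sum.cong) (simp_all add: ee_add scaleR_conv_of_real mult_ac)
  define z where "z = restrict (\<lambda>_. 0::int) (modes L :: (nat \<times> 'd) set)"
  have z: "z \<in> signs L" by (simp add: z_def signs_def)
  have Z: "Z c = 0 \<longleftrightarrow> c = z" if "c \<in> signs L" for c
  proof
    assume "Z c = 0"
    have "c p = 0" if "p \<in> modes L" for p
    proof (rule ccontr)
      assume "c p \<noteq> 0"
      then have "Z c \<noteq> 0"
        unfolding Z_def using that signs_abs_le[OF \<open>c \<in> signs L\<close>]
        by (intro frequencies_nonresonant[where c = c and ?p0.0 = p]) simp_all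
      with \<open>Z c = 0\<close> show False by simp
    qed
    then show "c = z" using \<open>c \<in> signs L\<close> unfolding z_def signs_def
      by (intro PiE_ext[where k = "modes L" and s = "\<lambda>_. {-1, 0, 1}"]) auto
  qed (simp add: Z_def z_def)
  have "complex_of_real (\<integral>t. indicator {0..1} t * riesz L (x - (2 * t) *\<^sub>R node \<sigma>) t \<partial>lborel)
    = (\<integral>t. complex_of_real (indicator {0..1} t * riesz L (x - (2 * t) *\<^sub>R node \<sigma>) t) \<partial>lborel)"
    by (rule integral_complex_of_real[symmetric])
  also have "\<dots> = (\<Sum>c\<in>signs L. (of_real (amp L c) * ee (K c)) * (if Z c = 0 then 1 else 0))"
    unfolding split by (subst Bochner_Integration.integral_sum)
      (simp_all add: integrable_ee_interval integral_ee_interval[where p = 1] del: mult_scaleR_right, intro sum.cong, auto)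
  also have "\<dots> = (\<Sum>c\<in>signs L. if c = z then of_real (amp L c) * ee (K c) else 0)"
    by (intro sum.cong) (simp_all add: Z)
  also have "\<dots> = of_real (amp L z) * ee (K z)"
    using z by simp
  also have "\<dots> = 1" by (simp add: amp_def K_def z_def)
  finally show ?thesis by (simp only: of_real_eq_1_iff)
qed

definition choices :: "nat \<Rightarrow> ('d::finite \<Rightarrow> nat) set" where
  "choices L = {\<sigma>. \<forall>j. \<sigma> j < L}"

lemma choices_PiE: "choices L = PiE UNIV (\<lambda>_. {..<L})"
  by (auto simp: choices_def PiE_def)

lemma finite_choices [simp]: "finite (choices L)"
  unfolding choices_PiE by (intro finite_PiE) auto

lemma card_choices: "card (choices L :: ('d::finite \<Rightarrow> nat) set) = L ^ CARD('d)"
  unfolding choices_PiE by (subst card_PiE) auto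

definition wave :: "nat \<Rightarrow> real ^ 'd::finite \<Rightarrow> real \<Rightarrow> complex" where
  "wave L x t = (\<Sum>\<sigma>\<in>choices L. ee (x \<bullet> node \<sigma> + t * (norm (node \<sigma>))\<^sup>2))"

text \<open>
  The indicator of the modes of a node: it writes the phase of the plane wave at a node as a signed sum over modes,
  the form that the phases of the Riesz product have.
\<close>

definition pick :: "('d::finite \<Rightarrow> nat) \<Rightarrow> nat \<times> 'd \<Rightarrow> int" where
  "pick \<sigma> p = (if fst p = \<sigma> (snd p) then 1 else 0)"

lemma sum_pick:
  fixes f :: "nat \<times> 'd::finite \<Rightarrow> real"
  assumes "\<sigma> \<in> choices L"
  shows "(\<Sum>p\<in>modes L. of_int (pick \<sigma> p) * f p) = (\<Sum>j\<in>UNIV. f (\<sigma> j, j))"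
proof -
  have "(\<Sum>p\<in>modes L. of_int (pick \<sigma> p) * f p) = (\<Sum>j\<in>UNIV. \<Sum>i<L. if i = \<sigma> j then f (i, j) else 0)"
    unfolding modes_def by (subst sum.swap, subst sum.cartesian_product)
      (auto simp: pick_def intro!: sum.cong)
  also have "\<dots> = (\<Sum>j\<in>UNIV. f (\<sigma> j, j))"
    using assms by (simp add: choices_def)
  finally show ?thesis .
qed

lemma wave_phase:
  assumes "\<sigma> \<in> choices L"
  shows "x \<bullet> node \<sigma> + t * (norm (node \<sigma>))\<^sup>2 = (\<Sum>p\<in>modes L. of_int (pick \<sigma> p) * angle p x t)"
  unfolding sum_pick[OF assms] power2_norm_eq_inner
  by (simp add: angle_def node_def inner_vec_def sum.distrib sum_distrib_left power2_eq_square mult_ac)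

text \<open>
  In each coordinate at most two modes have a nonzero sign, which costs at most \<open>(1 / 2)\<^sup>2\<close>.
\<close>

lemma amp_pick_diff:
  assumes "\<sigma> \<in> choices L" "\<tau> \<in> choices L"
  shows "(1 / 4) ^ CARD('d) \<le> amp L (\<lambda>p. pick \<tau> p - pick \<sigma> (p :: nat \<times> 'd::finite))"
proof -
  have "(1 / 4) ^ CARD('d) = (\<Prod>j\<in>(UNIV :: 'd set). (\<Prod>i<L. if i = \<sigma> j then 1 / 2 else 1) * (\<Prod>i<L. if i = \<tau> j then 1 / 2 else 1 :: real))"
    using assms by (simp add: choices_def)
  also have "\<dots> = (\<Prod>j\<in>(UNIV :: 'd set). \<Prod>i<L. (if i = \<sigma> j then 1 / 2 else 1) * (if i = \<tau> j then 1 / 2 else 1))"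
    by (simp add: prod.distrib)
  also have "\<dots> \<le> (\<Prod>j\<in>(UNIV :: 'd set). \<Prod>i<L. if pick \<tau> (i, j) - pick \<sigma> (i, j) = 0 then 1 else 1 / 2)"
    by (intro prod_mono conjI prod_nonneg ballI) (auto simp: pick_def)
  also have "\<dots> = amp L (\<lambda>p. pick \<tau> p - pick \<sigma> p)"
    unfolding amp_def modes_def by (subst prod.swap, subst prod.cartesian_product) (simp add: case_prod_unfold)
  finally show ?thesis .
qed

text \<open>
  Expanding all factors gives a sum over triples \<open>(\<sigma>, \<tau>, c)\<close> with positive coefficients, and the mean is the
  sum of the coefficients of the constant terms. For every pair \<open>(\<sigma>, \<tau>)\<close> the sign vector \<open>pick \<tau> - pick \<sigma>\<close>
  produces one, and positivity allows all others to be discarded.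
\<close>

lemma wave_riesz_mean:
  fixes L R :: nat
  shows "ennreal ((2 * real R) ^ CARD('d) * (real L ^ (2 * CARD('d)) * (1 / 4) ^ CARD('d)))
    \<le> (\<integral>\<^sup>+t\<in>{0..1}. (\<integral>\<^sup>+x. ennreal ((cmod (wave L x t))\<^sup>2 * riesz L x t) *
          indicator (cbox (\<chi> j. - real R) (\<chi> j. real R)) (x :: real ^ 'd::finite) \<partial>lborel) \<partial>lborel)"
proof -
  let ?C = "choices L :: ('d \<Rightarrow> nat) set" and ?S = "signs L :: (nat \<times> 'd \<Rightarrow> int) set"
  define Q where "Q = ?C \<times> ?C \<times> ?S"
  define b where "b = (\<lambda>(\<sigma>, \<tau>, c) p. pick \<sigma> p - pick \<tau> p + c (p :: nat \<times> 'd))"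
  define A where "A = (\<lambda>(\<sigma> :: 'd \<Rightarrow> nat, \<tau> :: 'd \<Rightarrow> nat, c :: nat \<times> 'd \<Rightarrow> int). amp L c)"
  define M where "M q j = (\<Sum>i<L. b q (i, j) * freq (i, j))" for q j
  define Z where "Z q = (\<Sum>p\<in>modes L. b q p * (freq p)\<^sup>2)" for q
  have phase: "(\<Sum>p\<in>modes L. of_int (b q p) * angle p x t) = (\<Sum>j\<in>UNIV. of_int (M q j) * x $ j) + of_int (Z q) * t" for q x t
  proof -
    have "(\<Sum>j\<in>UNIV. of_int (M q j) * x $ j) = (\<Sum>j\<in>UNIV. \<Sum>i<L. of_int (b q (i, j)) * (of_int (freq (i, j)) * x $ j))"
      by (simp add: M_def sum_distrib_right mult.assoc)
    also have "\<dots> = (\<Sum>p\<in>modes L. of_int (b q p) * (of_int (freq p) * x $ snd p))"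
      unfolding modes_def by (subst sum.swap, subst sum.cartesian_product) (simp add: case_prod_unfold)
    finally show ?thesis
      by (simp add: Z_def angle_def distrib_left sum.distrib sum_distrib_right mult.assoc)
  qed
  have F: "complex_of_real ((cmod (wave L x t))\<^sup>2 * riesz L x t)
    = (\<Sum>q\<in>Q. of_real (A q) * ee ((\<Sum>j\<in>UNIV. of_int (M q j) * x $ j) + of_int (Z q) * t))" for x :: "real ^ 'd" and t
  proof -
    have "complex_of_real ((cmod (wave L x t))\<^sup>2) = wave L x t * cnj (wave L x t)"
      by (rule complex_norm_square)
    also have "\<dots> = (\<Sum>\<sigma>\<in>?C. \<Sum>\<tau>\<in>?C. ee (\<Sum>p\<in>modes L. of_int (pick \<sigma> p) * angle p x t) * ee (- (\<Sum>p\<in>modes L. of_int (pick \<tau> p) * angle p x t)))"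
      unfolding wave_def by (simp add: wave_phase ee_minus sum_product)
    finally have "complex_of_real ((cmod (wave L x t))\<^sup>2 * riesz L x t)
      = (\<Sum>\<sigma>\<in>?C. \<Sum>\<tau>\<in>?C. \<Sum>c\<in>?S. of_real (amp L c) * (ee (\<Sum>p\<in>modes L. of_int (pick \<sigma> p) * angle p x t) *
          ee (- (\<Sum>p\<in>modes L. of_int (pick \<tau> p) * angle p x t)) * ee (\<Sum>p\<in>modes L. of_int (c p) * angle p x t)))"
      by (simp add: riesz_expansion sum_distrib_left sum_distrib_right mult_ac)
    also have "\<dots> = (\<Sum>q\<in>Q. of_real (A q) * ee (\<Sum>p\<in>modes L. of_int (b q p) * angle p x t))"
      unfolding Q_def sum.cartesian_product'
      by (simp add: A_def b_def ee_add[symmetric] sum.distrib sum_subtractf distrib_right left_diff_distrib)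
    finally show ?thesis by (simp only: phase)
  qed
  let ?Q0 = "{q. q \<in> Q \<and> (\<forall>j. M q j = 0) \<and> Z q = 0}"
  define h where "h = (\<lambda>(\<sigma>, \<tau>). (\<sigma>, \<tau>, restrict (\<lambda>p. pick \<tau> p - pick \<sigma> p) (modes L :: (nat \<times> 'd) set)))"
  have fin: "finite Q" by (simp add: Q_def)
  have inj: "inj_on h (?C \<times> ?C)" by (auto simp: inj_on_def h_def)
  have sub: "h ` (?C \<times> ?C) \<subseteq> ?Q0"
  proof
    fix q assume "q \<in> h ` (?C \<times> ?C)"
    then obtain \<sigma> \<tau> where q: "q = h (\<sigma>, \<tau>)" "\<sigma> \<in> ?C" "\<tau> \<in> ?C" by auto
    have "b q p = 0" if "p \<in> modes L" for p
      using that by (simp add: q(1) h_def b_def)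
    then have "M q j = 0" "Z q = 0" for j by (auto simp: M_def Z_def modes_def)
    moreover have "q \<in> Q" using q by (auto simp: Q_def h_def signs_def pick_def)
    ultimately show "q \<in> ?Q0" by simp
  qed
  have "real L ^ (2 * CARD('d)) * (1 / 4) ^ CARD('d) = (\<Sum>z\<in>?C \<times> ?C. (1 / 4) ^ CARD('d))"
    by (simp add: card_cartesian_product card_choices power_add mult_2)
  also have "\<dots> \<le> (\<Sum>z\<in>?C \<times> ?C. A (h z))"
  proof (rule sum_mono)
    fix z assume "z \<in> ?C \<times> ?C"
    then obtain \<sigma> \<tau> where z: "z = (\<sigma>, \<tau>)" "\<sigma> \<in> ?C" "\<tau> \<in> ?C" by auto
    have "A (h z) = amp L (\<lambda>p. pick \<tau> p - pick \<sigma> p)"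
      by (simp add: z(1) A_def h_def amp_def)
    then show "(1 / 4) ^ CARD('d) \<le> A (h z)" using amp_pick_diff[OF z(2,3)] by simp
  qed
  also have "\<dots> = (\<Sum>q\<in>h ` (?C \<times> ?C). A q)"
    using inj by (simp add: sum.reindex)
  also have "\<dots> \<le> (\<Sum>q\<in>?Q0. A q)"
    using sub fin by (intro sum_mono2) (auto simp: A_def less_imp_le[OF amp_pos])
  finally have "ennreal ((2 * real R) ^ CARD('d) * (real L ^ (2 * CARD('d)) * (1 / 4) ^ CARD('d)))
    \<le> ennreal ((2 * real R) ^ CARD('d) * (\<Sum>q\<in>?Q0. A q))"
    by (intro ennreal_leI mult_left_mono) auto
  also have "\<dots> = (\<integral>\<^sup>+t\<in>{0..1}. (\<integral>\<^sup>+x. ennreal ((cmod (wave L x t))\<^sup>2 * riesz L x t) *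
          indicator (cbox (\<chi> j. - real R) (\<chi> j. real R)) (x :: real ^ 'd) \<partial>lborel) \<partial>lborel)"
    by (rule trig_mean[symmetric, OF fin _ F]) (simp add: riesz_nonneg)
  finally show ?thesis .
qed

section \<open>The space_datum datum\<close>

definition bump :: "real \<Rightarrow> real ^ 'd::finite \<Rightarrow> real" where
  "bump \<epsilon> \<xi> = (\<Prod>j\<in>UNIV. tent \<epsilon> (\<xi> $ j))"

lemma borel_measurable_vec_nth [measurable]: "(\<lambda>x :: real ^ 'd. x $ j) \<in> borel_measurable borel"
  by (intro borel_measurable_continuous_onI continuous_intros)

lemma borel_measurable_bump [measurable]: "bump \<epsilon> \<in> borel_measurable borel"
  unfolding bump_def by measurable

lemma bump_nonneg: "0 \<le> bump \<epsilon> \<xi>"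
  unfolding bump_def by (intro prod_nonneg) (simp add: tent_nonneg)

lemma bump_le_1: "\<epsilon> > 0 \<Longrightarrow> bump \<epsilon> \<xi> \<le> 1"
  unfolding bump_def by (intro prod_le_1) (simp add: tent_nonneg tent_le_1)

lemma bump_eq_0: "\<epsilon> > 0 \<Longrightarrow> \<epsilon> \<le> \<bar>\<xi> $ j\<bar> \<Longrightarrow> bump \<epsilon> \<xi> = 0"
  unfolding bump_def by (rule prod_zero) (auto intro!: bexI[of _ j] tent_eq_0)

lemma bump_integral:
  assumes "\<epsilon> > 0"
  shows "has_bochner_integral lborel (bump \<epsilon> :: real ^ 'd::finite \<Rightarrow> real) (\<epsilon> ^ CARD('d))"
proof -
  have int: "integrable lborel (\<lambda>y. complex_of_real (tent \<epsilon> y))"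
    using tent_integral[OF assms] by (simp add: has_bochner_integral_iff)
  have "integrable lborel (\<lambda>x :: real ^ 'd. complex_of_real (bump \<epsilon> x))"
    using lborel_prod_vec(1)[OF int] by (simp add: bump_def)
  moreover have "complex_of_real (\<integral>x. bump \<epsilon> (x :: real ^ 'd) \<partial>lborel) = of_real (\<epsilon> ^ CARD('d))"
    using lborel_prod_vec(2)[where f = "\<lambda>_ :: 'd. \<lambda>y. complex_of_real (tent \<epsilon> y)", OF int]
    unfolding integral_complex_of_real[symmetric]
    by (simp add: bump_def tent_integral[OF assms, THEN has_bochner_integral_integral_eq])
  ultimately show ?thesis
    by (simp only: has_bochner_integral_iff complex_of_real_integrable_eq of_real_eq_iff)
qed

lemma integrable_bump: "\<epsilon> > 0 \<Longrightarrow> integrable lborel (bump \<epsilon> :: real ^ 'd::finite \<Rightarrow> real)"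
  and integral_bump: "\<epsilon> > 0 \<Longrightarrow> integral\<^sup>L lborel (bump \<epsilon> :: real ^ 'd::finite \<Rightarrow> real) = \<epsilon> ^ CARD('d)"
  using bump_integral[of \<epsilon>, where 'd = 'd] by (simp_all add: has_bochner_integral_iff)

lemma integrable_bump_ee:
  assumes "\<epsilon> > 0" and [measurable]: "\<theta> \<in> borel_measurable borel"
  shows "integrable lborel (\<lambda>\<xi> :: real ^ 'd::finite. of_real (bump \<epsilon> \<xi>) * ee (\<theta> \<xi>))"
  by (rule Bochner_Integration.integrable_bound[OF integrable_bump[OF assms(1)]])
     (auto simp: norm_mult bump_nonneg)

text \<open>
  Used twice: to replace the shifted packet at a node by the packet at the origin, and to bound the latter from
  below by comparison with the trivial phase.
\<close>

lemma bump_phase_perturb: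
  fixes \<theta> \<phi> :: "real ^ 'd::finite \<Rightarrow> real"
  assumes "\<epsilon> > 0" and [measurable]: "\<theta> \<in> borel_measurable borel" "\<phi> \<in> borel_measurable borel"
    and close: "\<And>\<xi>. (\<And>j. \<bar>\<xi> $ j\<bar> \<le> \<epsilon>) \<Longrightarrow> \<bar>\<theta> \<xi> - \<phi> \<xi>\<bar> \<le> \<delta>"
  shows "cmod ((\<integral>\<xi>. of_real (bump \<epsilon> \<xi>) * ee (\<theta> \<xi>) \<partial>lborel) - (\<integral>\<xi>. of_real (bump \<epsilon> \<xi>) * ee (\<phi> \<xi>) \<partial>lborel))
    \<le> \<epsilon> ^ CARD('d) * (2 * pi * \<delta>)"
proof -
  have "cmod ((\<integral>\<xi>. of_real (bump \<epsilon> \<xi>) * ee (\<theta> \<xi>) \<partial>lborel) - (\<integral>\<xi>. of_real (bump \<epsilon> \<xi>) * ee (\<phi> \<xi>) \<partial>lborel))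
    = cmod (\<integral>\<xi>. of_real (bump \<epsilon> \<xi>) * ee (\<theta> \<xi>) - of_real (bump \<epsilon> \<xi>) * ee (\<phi> \<xi>) \<partial>lborel)"
    using assms by (subst Bochner_Integration.integral_diff) (simp_all add: integrable_bump_ee)
  also have "\<dots> \<le> (\<integral>\<xi>. bump \<epsilon> (\<xi> :: real ^ 'd) * (2 * pi * \<delta>) \<partial>lborel)"
  proof (rule Bochner_Integration.integral_norm_bound_integral)
    fix \<xi> :: "real ^ 'd"
    show "cmod (of_real (bump \<epsilon> \<xi>) * ee (\<theta> \<xi>) - of_real (bump \<epsilon> \<xi>) * ee (\<phi> \<xi>)) \<le> bump \<epsilon> \<xi> * (2 * pi * \<delta>)"
    proof (cases "\<forall>j. \<bar>\<xi> $ j\<bar> \<le> \<epsilon>")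
      case True
      have "cmod (of_real (bump \<epsilon> \<xi>) * ee (\<theta> \<xi>) - of_real (bump \<epsilon> \<xi>) * ee (\<phi> \<xi>)) = bump \<epsilon> \<xi> * cmod (ee (\<theta> \<xi>) - ee (\<phi> \<xi>))"
        by (simp add: right_diff_distrib[symmetric] norm_mult bump_nonneg)
      also have "\<dots> \<le> bump \<epsilon> \<xi> * (2 * pi * \<bar>\<theta> \<xi> - \<phi> \<xi>\<bar>)"
        by (intro mult_left_mono norm_ee_diff_le bump_nonneg)
      also have "\<dots> \<le> bump \<epsilon> \<xi> * (2 * pi * \<delta>)"
        using True by (intro mult_left_mono close bump_nonneg) auto
      finally show ?thesis .
    next
      case False
      then obtain j where "\<epsilon> \<le> \<bar>\<xi> $ j\<bar>" by (metis linear)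
      then show ?thesis using assms(1) by (simp add: bump_eq_0)
    qed
  qed (use assms in \<open>auto intro!: integrable_bump_ee integrable_bump\<close>)
  also have "\<dots> = \<epsilon> ^ CARD('d) * (2 * pi * \<delta>)"
    using integral_bump[OF assms(1), where 'd = 'd] by simp
  finally show ?thesis .
qed

text \<open>
  The prescribed transform is a sum of bumps at the nodes. Its inverse transform, the exponential sum over the nodes
  times a product of Fejer kernels, is integrable and can be transformed back factor by factor.
\<close>

definition freq_datum :: "nat \<Rightarrow> real \<Rightarrow> real ^ 'd::finite \<Rightarrow> complex" where
  "freq_datum L \<epsilon> \<xi> = (\<Sum>\<sigma>\<in>choices L. of_real (bump \<epsilon> (\<xi> - node \<sigma>)))"

definition space_datum :: "nat \<Rightarrow> real \<Rightarrow> real ^ 'd::finite \<Rightarrow> complex" where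
  "space_datum L \<epsilon> x = (\<Sum>\<sigma>\<in>choices L. ee (x \<bullet> node \<sigma>) * (\<Prod>j\<in>UNIV. of_real (fejer \<epsilon> (x $ j))))"

lemma fejer_prod_transform:
  fixes a :: "real ^ 'd::finite"
  assumes "\<epsilon> > 0"
  shows "integrable lborel (\<lambda>x. ee (x \<bullet> a) * (\<Prod>j\<in>UNIV. of_real (fejer \<epsilon> (x $ j))))"
    and "(\<integral>x. ee (x \<bullet> a) * (\<Prod>j\<in>UNIV. of_real (fejer \<epsilon> (x $ j))) \<partial>lborel) = of_real (bump \<epsilon> a)"
proof -
  have split: "ee (x \<bullet> a) * (\<Prod>j\<in>UNIV. of_real (fejer \<epsilon> (x $ j)))
      = (\<Prod>j\<in>UNIV. of_real (fejer \<epsilon> (x $ j)) * ee (a $ j * x $ j))" for x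
    by (simp add: inner_vec_def ee_sum prod.distrib mult_ac)
  have int: "integrable lborel (\<lambda>y. complex_of_real (fejer \<epsilon> y) * ee (a $ j * y))" for j
    using assms by (rule integrable_fejer_ee)
  show "integrable lborel (\<lambda>x. ee (x \<bullet> a) * (\<Prod>j\<in>UNIV. of_real (fejer \<epsilon> (x $ j))))"
    unfolding split by (rule lborel_prod_vec(1)[OF int])
  show "(\<integral>x. ee (x \<bullet> a) * (\<Prod>j\<in>UNIV. of_real (fejer \<epsilon> (x $ j))) \<partial>lborel) = of_real (bump \<epsilon> a)"
    unfolding split by (subst lborel_prod_vec(2)[OF int]) (simp add: fejer_transform[OF assms] bump_def)
qed

lemma bump_minus: "bump \<epsilon> (- \<xi>) = bump \<epsilon> \<xi>"
  by (simp add: bump_def tent_def)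

lemma integrable_space_datum: "\<epsilon> > 0 \<Longrightarrow> integrable lborel (space_datum L \<epsilon>)"
  unfolding space_datum_def by (intro Bochner_Integration.integrable_sum fejer_prod_transform(1))

lemma fourier_integral_space_datum:
  assumes "\<epsilon> > 0"
  shows "fourier_integral (space_datum L \<epsilon>) \<xi> = freq_datum L \<epsilon> \<xi>"
proof -
  have "space_datum L \<epsilon> x * ee (- (x \<bullet> \<xi>)) = (\<Sum>\<sigma>\<in>choices L. ee (x \<bullet> (node \<sigma> - \<xi>)) * (\<Prod>j\<in>UNIV. of_real (fejer \<epsilon> (x $ j))))" for x
    unfolding space_datum_def sum_distrib_right
    by (intro sum.cong) (simp_all add: ee_add[symmetric] inner_diff_right mult_ac flip: mult.assoc)
  then have "fourier_integral (space_datum L \<epsilon>) \<xi> = (\<integral>x. (\<Sum>\<sigma>\<in>choices L. ee (x \<bullet> (node \<sigma> - \<xi>)) * (\<Prod>j\<in>UNIV. of_real (fejer \<epsilon> (x $ j)))) \<partial>lborel)"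
    unfolding fourier_integral_def exp_neg_eq_ee by simp
  also have "\<dots> = (\<Sum>\<sigma>\<in>choices L. of_real (bump \<epsilon> (node \<sigma> - \<xi>)))"
    by (subst Bochner_Integration.integral_sum) (simp_all only: fejer_prod_transform[OF assms])
  also have "\<dots> = freq_datum L \<epsilon> \<xi>"
    unfolding freq_datum_def by (intro sum.cong refl) (metis bump_minus minus_diff_eq)
  finally show ?thesis .
qed

lemma nodes_separated:
  fixes \<sigma> \<tau> :: "'d::finite \<Rightarrow> nat"
  assumes "\<sigma> \<noteq> \<tau>"
  obtains j where "1 \<le> \<bar>node \<sigma> $ j - node \<tau> $ j\<bar>"
proof -
  from assms obtain j where "\<sigma> j \<noteq> \<tau> j" by auto
  then have "freq (\<sigma> j, j) \<noteq> freq (\<tau> j, j)" by (simp add: freq_eq_iff)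
  then have "1 \<le> \<bar>freq (\<sigma> j, j) - freq (\<tau> j, j)\<bar>" by linarith
  then have "1 \<le> \<bar>node \<sigma> $ j - node \<tau> $ j\<bar>"
    unfolding node_def by (simp only: vec_lambda_beta of_int_diff[symmetric] of_int_abs[symmetric] of_int_1_le_iff)
  then show ?thesis by (rule that)
qed

text \<open>
  One of the two Fejer factors in the square is at most \<open>\<epsilon>\<close>. With the other one left, the plane waves are exactly orthogonal, because the tent of
  width at most \<open>1\<close> vanishes at nonzero integers.
\<close>

lemma space_datum_L2:
  assumes "\<epsilon> > 0" "\<epsilon> \<le> 1"
  shows "square_integrable (space_datum L \<epsilon> :: real ^ 'd::finite \<Rightarrow> complex)"
    and "L2_norm_sq (space_datum L \<epsilon> :: real ^ 'd::finite \<Rightarrow> complex) \<le> ennreal (real L ^ CARD('d) * \<epsilon> ^ CARD('d))"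
proof -
  let ?C = "choices L :: ('d \<Rightarrow> nat) set"
  define P where "P x = (\<Prod>j\<in>UNIV. fejer \<epsilon> (x $ j))" for x :: "real ^ 'd"
  define H where "H x = (cmod (\<Sum>\<sigma>\<in>?C. ee (x \<bullet> node \<sigma>)))\<^sup>2 * (P x * \<epsilon> ^ CARD('d))" for x :: "real ^ 'd"
  have P: "0 \<le> P x" "P x \<le> \<epsilon> ^ CARD('d)" for x
    using fejer_nonneg[OF assms(1)] fejer_le[OF assms(1)]
      prod_mono[of UNIV "\<lambda>j. fejer \<epsilon> (x $ j)" "\<lambda>_. \<epsilon>"]
    by (auto simp: P_def intro!: prod_nonneg)
  have le: "(cmod (space_datum L \<epsilon> x))\<^sup>2 \<le> H x" for x :: "real ^ 'd"
  proof -
    have "(cmod (space_datum L \<epsilon> x))\<^sup>2 = (cmod (\<Sum>\<sigma>\<in>?C. ee (x \<bullet> node \<sigma>)))\<^sup>2 * (P x * P x)"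
      unfolding space_datum_def sum_distrib_right[symmetric] of_real_prod[symmetric] P_def[symmetric]
      by (simp add: norm_mult power_mult_distrib power2_eq_square)
    also have "\<dots> \<le> H x"
      unfolding H_def using P[of x] by (intro mult_left_mono) auto
    finally show ?thesis .
  qed
  have expand: "complex_of_real (H x) = (\<Sum>\<sigma>\<in>?C. \<Sum>\<tau>\<in>?C.
      of_real (\<epsilon> ^ CARD('d)) * (ee (x \<bullet> (node \<sigma> - node \<tau>)) * (\<Prod>j\<in>UNIV. of_real (fejer \<epsilon> (x $ j)))))" for x
    unfolding H_def of_real_mult complex_norm_square P_def
    by (simp add: sum_product sum_distrib_left sum_distrib_right inner_diff_right ee_diff mult_ac) (rule sum.swap)
  have int_H: "integrable lborel H"
    unfolding complex_of_real_integrable_eq[symmetric] expand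
    by (intro Bochner_Integration.integrable_sum integrable_mult_right fejer_prod_transform(1) assms)
  have bump_nodes: "bump \<epsilon> (node \<sigma> - node \<tau>) = (if \<sigma> = \<tau> then 1 else 0)" for \<sigma> \<tau> :: "'d \<Rightarrow> nat"
  proof (cases "\<sigma> = \<tau>")
    case True
    then show ?thesis by (simp add: bump_def tent_def)
  next
    case False
    then obtain j where "1 \<le> \<bar>node \<sigma> $ j - node \<tau> $ j\<bar>" by (rule nodes_separated)
    then show ?thesis using False assms bump_eq_0[of \<epsilon> "node \<sigma> - node \<tau>" j] by simp
  qed
  have "complex_of_real (integral\<^sup>L lborel H) = (\<integral>x. complex_of_real (H x) \<partial>lborel)"
    by (rule integral_complex_of_real[symmetric])
  also have "\<dots> = (\<Sum>\<sigma>\<in>?C. \<Sum>\<tau>\<in>?C. of_real (\<epsilon> ^ CARD('d)) * of_real (bump \<epsilon> (node \<sigma> - node \<tau>)))"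
    unfolding expand using fejer_prod_transform[OF assms(1)]
    by (intro has_bochner_integral_integral_eq has_bochner_integral_sum has_bochner_integral_mult_right)
       (simp only: has_bochner_integral_iff, blast)
  also have "\<dots> = complex_of_real (real L ^ CARD('d) * \<epsilon> ^ CARD('d))"
    by (simp add: bump_nodes card_choices if_distrib[of of_real] if_distrib[of "(*) _"] cong: if_cong)
  finally have val: "integral\<^sup>L lborel H = real L ^ CARD('d) * \<epsilon> ^ CARD('d)"
    by (simp only: of_real_eq_iff)
  have [measurable]: "(space_datum L \<epsilon> :: real ^ 'd \<Rightarrow> complex) \<in> borel_measurable borel"
    using borel_measurable_integrable[OF integrable_space_datum[OF assms(1)]] by simp
  have H_nonneg: "0 \<le> H x" for x using le[of x] by (meson order_trans zero_le_power2)
  have "integrable lborel (\<lambda>x :: real ^ 'd. (cmod (space_datum L \<epsilon> x))\<^sup>2)"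
    by (rule Bochner_Integration.integrable_bound[OF int_H]) (auto simp: le H_nonneg)
  then show "square_integrable (space_datum L \<epsilon> :: real ^ 'd \<Rightarrow> complex)"
    by (simp add: square_integrable_def)
  have "L2_norm_sq (space_datum L \<epsilon> :: real ^ 'd \<Rightarrow> complex) \<le> (\<integral>\<^sup>+x. ennreal (H x) \<partial>lborel)"
    unfolding L2_norm_sq_def by (intro nn_integral_mono ennreal_leI le)
  also have "\<dots> = ennreal (real L ^ CARD('d) * \<epsilon> ^ CARD('d))"
    using int_H by (simp add: nn_integral_eq_integral H_nonneg val)
  finally show "L2_norm_sq (space_datum L \<epsilon> :: real ^ 'd \<Rightarrow> complex) \<le> ennreal (real L ^ CARD('d) * \<epsilon> ^ CARD('d))" .
qed

lemma borel_measurable_freq_datum [measurable]: "freq_datum L \<epsilon> \<in> borel_measurable borel"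
  unfolding freq_datum_def by measurable

lemma freq_datum_nonzeroE:
  assumes "\<epsilon> > 0" "freq_datum L \<epsilon> \<xi> \<noteq> 0"
  obtains \<sigma> where "\<sigma> \<in> choices L" "\<And>j. \<bar>\<xi> $ j - node \<sigma> $ j\<bar> \<le> \<epsilon>"
proof -
  obtain \<sigma> where \<sigma>: "\<sigma> \<in> choices L" "bump \<epsilon> (\<xi> - node \<sigma>) \<noteq> 0"
    using assms(2) unfolding freq_datum_def by (metis (no_types, lifting) of_real_0 sum.neutral)
  have "\<bar>\<xi> $ j - node \<sigma> $ j\<bar> \<le> \<epsilon>" for j
    using bump_eq_0[OF assms(1), of "\<xi> - node \<sigma>" j] \<sigma>(2) by (smt (verit) vector_minus_component)
  with \<sigma>(1) show ?thesis by (rule that)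
qed

lemma translate_lborel:
  fixes f :: "'a::euclidean_space \<Rightarrow> complex"
  assumes [measurable]: "f \<in> borel_measurable borel"
  shows "integrable lborel (\<lambda>x. f (x - a)) \<longleftrightarrow> integrable lborel f"
    and "(\<integral>x. f (x - a) \<partial>lborel) = integral\<^sup>L lborel f"
proof -
  have shift: "(lborel :: 'a measure) = distr lborel borel (\<lambda>x. - a + x)"
    by (metis lborel_distr_plus)
  show "integrable lborel (\<lambda>x. f (x - a)) \<longleftrightarrow> integrable lborel f"
    by (subst (2) shift, subst integrable_distr_eq) simp_all
  show "(\<integral>x. f (x - a) \<partial>lborel) = integral\<^sup>L lborel f"
    by (subst (2) shift, subst integral_distr) simp_all
qed

text \<open>
  The bumps have disjoint supports, hence their sum is at most \<open>1\<close> and its square is at most itself.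
\<close>

lemma freq_datum_L2:
  assumes "\<epsilon> > 0" "\<epsilon> < 1 / 2"
  shows "square_integrable (freq_datum L \<epsilon> :: real ^ 'd::finite \<Rightarrow> complex)"
    and "L2_norm_sq (freq_datum L \<epsilon> :: real ^ 'd::finite \<Rightarrow> complex) \<le> ennreal (real L ^ CARD('d) * \<epsilon> ^ CARD('d))"
proof -
  let ?C = "choices L :: ('d \<Rightarrow> nat) set"
  define D where "D \<xi> = (\<Sum>\<sigma>\<in>?C. bump \<epsilon> (\<xi> - node \<sigma>))" for \<xi> :: "real ^ 'd"
  have D: "freq_datum L \<epsilon> \<xi> = of_real (D \<xi>)" for \<xi> :: "real ^ 'd" by (simp add: freq_datum_def D_def)
  have D_nonneg: "0 \<le> D \<xi>" for \<xi> unfolding D_def by (intro sum_nonneg bump_nonneg)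
  have D_le: "D \<xi> \<le> 1" for \<xi>
  proof (cases "\<exists>\<sigma>\<in>?C. bump \<epsilon> (\<xi> - node \<sigma>) \<noteq> 0")
    case True
    then obtain \<sigma> where \<sigma>: "\<sigma> \<in> ?C" "bump \<epsilon> (\<xi> - node \<sigma>) \<noteq> 0" by auto
    have "bump \<epsilon> (\<xi> - node \<tau>) = 0" if "\<tau> \<noteq> \<sigma>" for \<tau> :: "'d \<Rightarrow> nat"
    proof -
      obtain j where j: "1 \<le> \<bar>node \<tau> $ j - node \<sigma> $ j\<bar>" using \<open>\<tau> \<noteq> \<sigma>\<close> by (rule nodes_separated)
      have "\<bar>(\<xi> - node \<sigma>) $ j\<bar> < \<epsilon>" using \<sigma>(2) bump_eq_0[OF assms(1)] by (meson not_le)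
      with j assms(2) have "\<epsilon> \<le> \<bar>(\<xi> - node \<tau>) $ j\<bar>" by (simp add: abs_if split: if_splits)
      then show ?thesis using assms(1) by (intro bump_eq_0)
    qed
    then have "D \<xi> = (\<Sum>\<tau>\<in>{\<sigma>}. bump \<epsilon> (\<xi> - node \<tau>))"
      unfolding D_def using \<sigma>(1) by (intro sum.mono_neutral_right) auto
    then show ?thesis using bump_le_1[OF assms(1)] by simp
  qed (simp add: D_def)
  have sh: "integrable lborel (\<lambda>\<xi>. complex_of_real (bump \<epsilon> (\<xi> - node \<sigma>)))"
    "(\<integral>\<xi>. complex_of_real (bump \<epsilon> (\<xi> - node \<sigma>)) \<partial>lborel) = of_real (\<epsilon> ^ CARD('d))" for \<sigma> :: "'d \<Rightarrow> nat"
    using translate_lborel[of "\<lambda>\<xi> :: real ^ 'd. complex_of_real (bump \<epsilon> \<xi>)" "node \<sigma>"]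
      integrable_bump[OF assms(1), where 'd = 'd] integral_bump[OF assms(1), where 'd = 'd]
    by (simp_all add: complex_of_real_integrable_eq)
  have int_D: "integrable lborel D"
    using sh(1) unfolding D_def complex_of_real_integrable_eq by (intro Bochner_Integration.integrable_sum)
  have val: "integral\<^sup>L lborel D = real L ^ CARD('d) * \<epsilon> ^ CARD('d)"
    using sh unfolding D_def complex_of_real_integrable_eq integral_complex_of_real of_real_eq_iff
    by (subst Bochner_Integration.integral_sum) (simp_all add: card_choices)
  have le: "(cmod (freq_datum L \<epsilon> \<xi>))\<^sup>2 \<le> D \<xi>" for \<xi> :: "real ^ 'd"
    using D_nonneg[of \<xi>] D_le[of \<xi>] by (simp add: D power2_eq_square mult_left_le)
  have "integrable lborel (\<lambda>x :: real ^ 'd. (cmod (freq_datum L \<epsilon> x))\<^sup>2)"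
    by (rule Bochner_Integration.integrable_bound[OF int_D]) (auto simp: le D_nonneg)
  then show "square_integrable (freq_datum L \<epsilon> :: real ^ 'd \<Rightarrow> complex)"
    by (simp add: square_integrable_def)
  have "L2_norm_sq (freq_datum L \<epsilon> :: real ^ 'd \<Rightarrow> complex) \<le> (\<integral>\<^sup>+x. ennreal (D x) \<partial>lborel)"
    unfolding L2_norm_sq_def by (intro nn_integral_mono ennreal_leI le)
  also have "\<dots> = ennreal (real L ^ CARD('d) * \<epsilon> ^ CARD('d))"
    using int_D by (simp add: nn_integral_eq_integral D_nonneg val)
  finally show "L2_norm_sq (freq_datum L \<epsilon> :: real ^ 'd \<Rightarrow> complex) \<le> ennreal (real L ^ CARD('d) * \<epsilon> ^ CARD('d))" .
qed

lemma is_fourier_transform_space_datum: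
  assumes "\<epsilon> > 0" "\<epsilon> < 1 / 2"
  shows "is_fourier_transform (space_datum L \<epsilon> :: real ^ 'd::finite \<Rightarrow> complex) (freq_datum L \<epsilon>)"
  unfolding is_fourier_transform_def
proof (intro conjI exI[of _ "\<lambda>_. space_datum L \<epsilon>"] allI)
  show "(\<lambda>n. L2_norm_sq (\<lambda>x :: real ^ 'd. space_datum L \<epsilon> x - space_datum L \<epsilon> x)) \<longlonglongrightarrow> 0"
    and "(\<lambda>n. L2_norm_sq (\<lambda>\<xi> :: real ^ 'd. fourier_integral (space_datum L \<epsilon>) \<xi> - freq_datum L \<epsilon> \<xi>)) \<longlonglongrightarrow> 0"
    by (simp_all add: L2_norm_sq_def fourier_integral_space_datum[OF assms(1)])
qed (use assms in \<open>auto intro: space_datum_L2(1) freq_datum_L2(1) integrable_space_datum\<close>)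

text \<open>
  The closed cubes around the nodes have a closed union, outside of which the datum vanishes identically.
\<close>

lemma ess_support_freq_datum:
  assumes "\<epsilon> > 0" "v \<in> ess_support (freq_datum L \<epsilon> :: real ^ 'd::finite \<Rightarrow> complex)"
  obtains \<sigma> where "\<sigma> \<in> choices L" "\<And>j. \<bar>v $ j - node \<sigma> $ j\<bar> \<le> \<epsilon>"
proof -
  define K where "K = (\<Union>\<sigma>\<in>(choices L :: ('d \<Rightarrow> nat) set). cbox (\<chi> j. node \<sigma> $ j - \<epsilon>) (\<chi> j. node \<sigma> $ j + \<epsilon>))"
  have K: "\<xi> \<in> K \<longleftrightarrow> (\<exists>\<sigma>\<in>choices L. \<forall>j. \<bar>\<xi> $ j - node \<sigma> $ j\<bar> \<le> \<epsilon>)" for \<xi>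
    by (auto simp: K_def mem_box_cart abs_le_iff algebra_simps)
  have "closed K" unfolding K_def by (intro closed_UN) auto
  have "v \<in> K"
  proof (rule ccontr)
    assume "v \<notin> K"
    then have "open (- K)" "v \<in> - K" using \<open>closed K\<close> by auto
    moreover have "AE \<xi> in lborel. \<xi> \<in> - K \<longrightarrow> freq_datum L \<epsilon> \<xi> = 0"
      using freq_datum_nonzeroE[OF assms(1)] K by (intro AE_I2) blast
    ultimately show False using assms(2) unfolding ess_support_def by blast
  qed
  then show ?thesis using K that by blast
qed

section \<open>Wave packets and the lower bound for the energy\<close>

definition freq_sum :: "'d::finite itself \<Rightarrow> nat \<Rightarrow> real" where
  "freq_sum _ L = (\<Sum>p\<in>(modes L :: (nat \<times> 'd) set). of_int (freq p))"

lemma node_l1_le: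
  fixes \<sigma> :: "'d::finite \<Rightarrow> nat"
  assumes "\<sigma> \<in> choices L"
  shows "(\<Sum>j\<in>UNIV. \<bar>node \<sigma> $ j\<bar>) \<le> freq_sum TYPE('d) L"
proof -
  have "(\<Sum>j\<in>UNIV. \<bar>node \<sigma> $ j\<bar>) = (\<Sum>j\<in>UNIV. real_of_int (freq (\<sigma> j, j)))"
    by (intro sum.cong) (simp_all add: node_def less_imp_le[OF freq_pos])
  also have "\<dots> = (\<Sum>p\<in>modes L. of_int (pick \<sigma> p) * real_of_int (freq p))"
    using sum_pick[OF assms, of "\<lambda>p. real_of_int (freq p)"] by simp
  also have "\<dots> \<le> freq_sum TYPE('d) L"
    unfolding freq_sum_def
    by (intro sum_mono) (auto simp: pick_def less_imp_le[OF freq_pos])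
  finally show ?thesis .
qed

lemma inner_box_le:
  fixes a b :: "real ^ 'd::finite"
  assumes "\<And>j. \<bar>b $ j\<bar> \<le> \<epsilon>"
  shows "\<bar>a \<bullet> b\<bar> \<le> (\<Sum>j\<in>UNIV. \<bar>a $ j\<bar>) * \<epsilon>"
proof -
  have "\<bar>a \<bullet> b\<bar> \<le> (\<Sum>j\<in>UNIV. \<bar>a $ j * b $ j\<bar>)"
    unfolding inner_vec_def by (simp add: sum_abs)
  also have "\<dots> \<le> (\<Sum>j\<in>UNIV. \<bar>a $ j\<bar> * \<epsilon>)"
    unfolding abs_mult by (intro sum_mono mult_left_mono assms) auto
  finally show ?thesis by (simp add: sum_distrib_right)
qed

text \<open>
  The solution with the bump at the origin as transform.
\<close>

definition packet :: "real \<Rightarrow> real ^ 'd::finite \<Rightarrow> real \<Rightarrow> complex" where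
  "packet \<epsilon> x t = (\<integral>\<xi>. of_real (bump \<epsilon> \<xi>) * ee (x \<bullet> \<xi> + t * (norm \<xi>)\<^sup>2) \<partial>lborel)"

text \<open>
  Translating a bump from a node \<open>\<nu>\<close> to the origin multiplies by the plane wave at \<open>\<nu>\<close> and leaves the
  extra phase \<open>2 * t * (\<nu> \<bullet> \<xi>)\<close>, the drift of the packet, which is negligible when \<open>\<epsilon>\<close> is small compared with
  the reciprocal of the frequencies.
\<close>

lemma schroedinger_freq_datum_approx:
  fixes x :: "real ^ 'd::finite"
  assumes "\<epsilon> > 0" "0 \<le> t" "t \<le> 1"
  shows "cmod (schroedinger (freq_datum L \<epsilon>) x t - wave L x t * packet \<epsilon> x t)
    \<le> real L ^ CARD('d) * (\<epsilon> ^ CARD('d) * (2 * pi * (2 * (freq_sum TYPE('d) L * \<epsilon>))))"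
proof -
  define J where "J \<sigma> = (\<integral>\<xi>. of_real (bump \<epsilon> \<xi>) * ee (x \<bullet> \<xi> + t * (norm \<xi>)\<^sup>2 + 2 * t * (node \<sigma> \<bullet> \<xi>)) \<partial>lborel)" for \<sigma> :: "'d \<Rightarrow> nat"
  let ?w = "\<lambda>\<sigma>. ee (x \<bullet> node \<sigma> + t * (norm (node \<sigma>))\<^sup>2)"
  let ?f = "\<lambda>\<sigma> \<xi>. ?w \<sigma> * (of_real (bump \<epsilon> \<xi>) * ee (x \<bullet> \<xi> + t * (norm \<xi>)\<^sup>2 + 2 * t * (node \<sigma> \<bullet> \<xi>)))"
  have shifted: "of_real (bump \<epsilon> (\<xi> - node \<sigma>)) * ee (x \<bullet> \<xi> + t * (norm \<xi>)\<^sup>2) = ?f \<sigma> (\<xi> - node \<sigma>)" for \<xi> \<sigma>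
  proof -
    have "x \<bullet> \<xi> + t * (norm \<xi>)\<^sup>2 = (x \<bullet> node \<sigma> + t * (norm (node \<sigma>))\<^sup>2)
      + (x \<bullet> (\<xi> - node \<sigma>) + t * (norm (\<xi> - node \<sigma>))\<^sup>2 + 2 * t * (node \<sigma> \<bullet> (\<xi> - node \<sigma>)))"
      by (simp add: power2_norm_eq_inner inner_diff_left inner_diff_right inner_commute algebra_simps)
    then show ?thesis by (simp only: ee_add mult_ac)
  qed
  have [measurable]: "(\<lambda>\<xi> :: real ^ 'd. x \<bullet> \<xi> + t * (norm \<xi>)\<^sup>2 + 2 * t * (node \<sigma> \<bullet> \<xi>)) \<in> borel_measurable borel" for \<sigma> :: "'d \<Rightarrow> nat"
    by (intro borel_measurable_continuous_onI continuous_intros)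
  have int: "integrable lborel (?f \<sigma>)" for \<sigma>
    using assms by (intro integrable_mult_right integrable_bump_ee) auto
  have "schroedinger (freq_datum L \<epsilon>) x t = (\<integral>\<xi>. (\<Sum>\<sigma>\<in>choices L. ?f \<sigma> (\<xi> - node \<sigma>)) \<partial>lborel)"
    unfolding schroedinger_def exp_eq_ee freq_datum_def sum_distrib_right shifted ..
  also have "\<dots> = (\<Sum>\<sigma>\<in>choices L. \<integral>\<xi>. ?f \<sigma> (\<xi> - node \<sigma>) \<partial>lborel)"
    using int by (intro Bochner_Integration.integral_sum) (subst translate_lborel(1), auto)
  also have "\<dots> = (\<Sum>\<sigma>\<in>choices L. ?w \<sigma> * J \<sigma>)"
    by (subst translate_lborel(2)) (simp_all add: J_def)
  finally have "schroedinger (freq_datum L \<epsilon>) x t - wave L x t * packet \<epsilon> x t = (\<Sum>\<sigma>\<in>choices L. ?w \<sigma> * (J \<sigma> - packet \<epsilon> x t))"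
    by (simp add: wave_def sum_distrib_right sum_subtractf right_diff_distrib)
  also have "cmod \<dots> \<le> (\<Sum>\<sigma>\<in>(choices L :: ('d \<Rightarrow> nat) set). \<epsilon> ^ CARD('d) * (2 * pi * (2 * (freq_sum TYPE('d) L * \<epsilon>))))"
  proof (rule sum_norm_le)
    fix \<sigma> :: "'d \<Rightarrow> nat" assume \<sigma>: "\<sigma> \<in> choices L"
    have "cmod (J \<sigma> - packet \<epsilon> x t) \<le> \<epsilon> ^ CARD('d) * (2 * pi * (2 * (freq_sum TYPE('d) L * \<epsilon>)))"
      unfolding J_def packet_def
    proof (rule bump_phase_perturb)
      fix \<xi> :: "real ^ 'd" assume \<xi>: "\<And>j. \<bar>\<xi> $ j\<bar> \<le> \<epsilon>"
      have "\<bar>node \<sigma> \<bullet> \<xi>\<bar> \<le> (\<Sum>j\<in>UNIV. \<bar>node \<sigma> $ j\<bar>) * \<epsilon>" using \<xi> by (rule inner_box_le)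
      also have "\<dots> \<le> freq_sum TYPE('d) L * \<epsilon>"
        using assms node_l1_le[OF \<sigma>] by (intro mult_right_mono) auto
      finally have "\<bar>node \<sigma> \<bullet> \<xi>\<bar> \<le> freq_sum TYPE('d) L * \<epsilon>" .
      then have "t * \<bar>node \<sigma> \<bullet> \<xi>\<bar> \<le> 1 * (freq_sum TYPE('d) L * \<epsilon>)"
        using assms by (intro mult_mono) auto
      then show "\<bar>x \<bullet> \<xi> + t * (norm \<xi>)\<^sup>2 + 2 * t * (node \<sigma> \<bullet> \<xi>) - (x \<bullet> \<xi> + t * (norm \<xi>)\<^sup>2)\<bar> \<le> 2 * (freq_sum TYPE('d) L * \<epsilon>)"
        using assms by (simp add: abs_mult)
    qed (use assms in measurable)
    then show "cmod (?w \<sigma> * (J \<sigma> - packet \<epsilon> x t)) \<le> \<epsilon> ^ CARD('d) * (2 * pi * (2 * (freq_sum TYPE('d) L * \<epsilon>)))"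
      by (simp add: norm_mult)
  qed
  also have "\<dots> = real L ^ CARD('d) * (\<epsilon> ^ CARD('d) * (2 * pi * (2 * (freq_sum TYPE('d) L * \<epsilon>))))"
    by (simp add: card_choices)
  finally show ?thesis .
qed

text \<open>
  For \<open>x\<close> in the box the phase is at most \<open>1 / 16\<close>, so that \<open>2 * \<pi> / 16 < 1 / 2\<close> bounds the relative error.
\<close>

lemma packet_lower:
  fixes x :: "real ^ 'd::finite"
  assumes \<epsilon>: "0 < \<epsilon>" "\<epsilon> \<le> 1" "32 * real CARD('d) * r * \<epsilon> \<le> 1" "r \<ge> 1"
    and t: "0 \<le> t" "t \<le> 1" and x: "\<And>j. \<bar>x $ j\<bar> \<le> r"
  shows "\<epsilon> ^ CARD('d) / 2 \<le> cmod (packet \<epsilon> x t)"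
proof -
  have "cmod (packet \<epsilon> x t - (\<integral>\<xi>. of_real (bump \<epsilon> (\<xi> :: real ^ 'd)) * ee 0 \<partial>lborel)) \<le> \<epsilon> ^ CARD('d) * (2 * pi * (1 / 16))"
    unfolding packet_def
  proof (rule bump_phase_perturb)
    fix \<xi> :: "real ^ 'd" assume \<xi>: "\<And>j. \<bar>\<xi> $ j\<bar> \<le> \<epsilon>"
    have "(\<Sum>j\<in>UNIV. \<bar>x $ j\<bar>) \<le> (\<Sum>j\<in>(UNIV :: 'd set). r)" by (intro sum_mono x)
    then have "(\<Sum>j\<in>UNIV. \<bar>x $ j\<bar>) * \<epsilon> \<le> real CARD('d) * r * \<epsilon>"
      using \<epsilon> by (intro mult_right_mono) auto
    then have 1: "\<bar>x \<bullet> \<xi>\<bar> \<le> 1 / 32"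
      using inner_box_le[of \<xi> \<epsilon> x, OF \<xi>] \<epsilon>(3) by linarith
    have "\<bar>\<xi> \<bullet> \<xi>\<bar> \<le> (\<Sum>j\<in>UNIV. \<bar>\<xi> $ j\<bar>) * \<epsilon>" using \<xi> by (rule inner_box_le)
    also have "\<dots> \<le> (\<Sum>j\<in>(UNIV :: 'd set). r) * \<epsilon>"
      using \<epsilon> \<xi> by (intro mult_right_mono sum_mono) (auto intro: order_trans)
    finally have "\<xi> \<bullet> \<xi> \<le> 1 / 32" using \<epsilon> by simp
    then have "t * (norm \<xi>)\<^sup>2 \<le> 1 * (1 / 32)"
      unfolding power2_norm_eq_inner using t by (intro mult_mono) auto
    then have 2: "\<bar>t * (norm \<xi>)\<^sup>2\<bar> \<le> 1 / 32" using t by (simp add: abs_mult)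
    show "\<bar>x \<bullet> \<xi> + t * (norm \<xi>)\<^sup>2 - 0\<bar> \<le> 1 / 16" using 1 2 by linarith
  qed (use \<epsilon> in measurable)
  also have "(\<integral>\<xi>. of_real (bump \<epsilon> (\<xi> :: real ^ 'd)) * ee 0 \<partial>lborel) = complex_of_real (\<epsilon> ^ CARD('d))"
    using integral_bump[OF \<epsilon>(1), where 'd = 'd] by simp
  finally have "cmod (packet \<epsilon> x t - of_real (\<epsilon> ^ CARD('d))) \<le> \<epsilon> ^ CARD('d) * (pi / 8)" by simp
  also have "\<dots> \<le> \<epsilon> ^ CARD('d) * (1 / 2)"
    using pi_less_4 \<epsilon> by (intro mult_left_mono) auto
  finally have "cmod (packet \<epsilon> x t - of_real (\<epsilon> ^ CARD('d))) \<le> \<epsilon> ^ CARD('d) / 2" by simp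
  moreover have "cmod (complex_of_real (\<epsilon> ^ CARD('d))) = \<epsilon> ^ CARD('d)" using \<epsilon> by (simp add: norm_power)
  ultimately show ?thesis
    using norm_triangle_ineq2[of "complex_of_real (\<epsilon> ^ CARD('d))" "packet \<epsilon> x t"]
    by (simp add: norm_minus_commute)
qed

definition riesz_weight :: "nat \<Rightarrow> (real ^ 'd::finite) \<times> real \<Rightarrow> real" where
  "riesz_weight L p = indicator {0..1} (snd p) * riesz L (fst p) (snd p)"

lemma weight_riesz_weight: "weight (riesz_weight L :: (real ^ 'd::finite) \<times> real \<Rightarrow> real)"
  unfolding weight_def
proof (intro conjI allI impI)
  show meas: "(riesz_weight L :: (real ^ 'd) \<times> real \<Rightarrow> real) \<in> borel_measurable borel"
    unfolding riesz_weight_def borel_prod[symmetric] by measurable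
  show nonneg: "0 \<le> riesz_weight L p" for p :: "(real ^ 'd) \<times> real"
    by (simp add: riesz_weight_def riesz_nonneg)
  have le: "riesz_weight L p \<le> 2 ^ (L * CARD('d))" for p :: "(real ^ 'd) \<times> real"
    by (auto simp: riesz_weight_def riesz_le indicator_def)
  fix K :: "((real ^ 'd) \<times> real) set" assume K: "compact K"
  then have fin: "emeasure lborel K < \<infinity>" by (rule emeasure_compact_finite)
  have [measurable]: "K \<in> sets borel" using K by (rule borel_compact)
  show "set_integrable lborel K (riesz_weight L)"
    unfolding set_integrable_def
  proof (rule Bochner_Integration.integrable_bound)
    show "integrable lborel (\<lambda>p. indicator K p * 2 ^ (L * CARD('d)) :: real)"
      using fin by (intro integrable_mult_left) (auto simp: integrable_indicator_iff)
    show "AE p in lborel. norm (indicat_real K p *\<^sub>R riesz_weight L p) \<le> norm (indicator K p * 2 ^ (L * CARD('d)) :: real)"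
      by (intro AE_I2) (auto simp: indicator_def le abs_of_nonneg[OF nonneg])
  qed (use meas in measurable)
qed

text \<open>
  At the node itself the integral is \<open>1\<close>; over unit time, moving the direction by \<open>\<epsilon>\<close> moves the points of the line by at
  most \<open>2 * \<epsilon>\<close>, and the Lipschitz bound for the Riesz product adds at most \<open>1\<close>.
\<close>

lemma rho_star_riesz_weight_le:
  fixes x v :: "real ^ 'd::finite"
  assumes v: "\<And>j. \<bar>v $ j - node \<sigma> $ j\<bar> \<le> \<epsilon>"
    and small: "2 ^ (L * CARD('d)) * (4 * pi * (\<epsilon> * freq_sum TYPE('d) L)) \<le> 1"
  shows "rho_star (riesz_weight L) x v \<le> 2"
proof -
  let ?g = "\<lambda>t. indicator {0..1} t * riesz L (x - (2 * t) *\<^sub>R node \<sigma>) t"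
  have eps: "0 \<le> \<epsilon>" using v by (meson abs_ge_zero order_trans)
  have "rho_star (riesz_weight L) x v \<le> (\<integral>\<^sup>+t. ennreal (?g t) + indicator {0..1} t \<partial>lborel)"
    unfolding rho_star_def
  proof (rule nn_integral_mono)
    fix t :: real
    show "ennreal (riesz_weight L (x - (2 * t) *\<^sub>R v, t)) \<le> ennreal (?g t) + indicator {0..1} t"
    proof (cases "t \<in> {0..1}")
      case True
      have "\<bar>riesz L (x - (2 * t) *\<^sub>R v) t - riesz L (x - (2 * t) *\<^sub>R node \<sigma>) t\<bar>
        \<le> 2 ^ (L * CARD('d)) * (2 * pi * ((2 * \<epsilon>) * (\<Sum>p\<in>(modes L :: (nat \<times> 'd) set). of_int (freq p))))"
      proof (rule riesz_lipschitz)
        fix j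
        have "\<bar>(x - (2 * t) *\<^sub>R v) $ j - (x - (2 * t) *\<^sub>R node \<sigma>) $ j\<bar> = 2 * t * \<bar>v $ j - node \<sigma> $ j\<bar>"
        proof -
          have "(x - (2 * t) *\<^sub>R v) $ j - (x - (2 * t) *\<^sub>R node \<sigma>) $ j = - (2 * t * (v $ j - node \<sigma> $ j))"
            by (simp add: algebra_simps)
          then show ?thesis using True by (simp add: abs_mult)
        qed
        also have "\<dots> \<le> 2 * 1 * \<epsilon>" using True v by (intro mult_mono) auto
        finally show "\<bar>(x - (2 * t) *\<^sub>R v) $ j - (x - (2 * t) *\<^sub>R node \<sigma>) $ j\<bar> \<le> 2 * \<epsilon>" by simp
      qed
      also have "\<dots> \<le> 1" using small by (simp add: freq_sum_def mult_ac)
      finally have "riesz L (x - (2 * t) *\<^sub>R v) t \<le> riesz L (x - (2 * t) *\<^sub>R node \<sigma>) t + 1" by linarith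
      then have "ennreal (riesz L (x - (2 * t) *\<^sub>R v) t) \<le> ennreal (riesz L (x - (2 * t) *\<^sub>R node \<sigma>) t + 1)"
        by (rule ennreal_leI)
      then show ?thesis using True by (simp add: riesz_weight_def riesz_nonneg)
    qed (simp add: riesz_weight_def)
  qed
  also have "\<dots> = (\<integral>\<^sup>+t. ennreal (?g t) \<partial>lborel) + 1"
    by (subst nn_integral_add) simp_all
  also have "(\<integral>\<^sup>+t. ennreal (?g t) \<partial>lborel) = ennreal (\<integral>t. ?g t \<partial>lborel)"
  proof (rule nn_integral_eq_integral)
    show "integrable lborel ?g"
      using riesz_line_mean[of L x \<sigma>] not_integrable_integral_eq by fastforce
  qed (simp add: riesz_nonneg)
  also have "ennreal (\<integral>t. ?g t \<partial>lborel) + 1 = 2" by (simp add: riesz_line_mean)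
  finally show ?thesis .
qed

text \<open>
  On the box \<open>|u| \<ge> |U| * \<epsilon> ^ D / 2 - \<epsilon> ^ D * \<kappa>\<close>, where \<open>\<kappa>\<close> is the drift error. Squaring loses a factor of two;
  the smallness assumption makes the total error at most half of the main term from \<open>wave_riesz_mean\<close>.
  The main term contains \<open>(2 * R) ^ D * \<epsilon> ^ (2 * D)\<close>, and \<open>\<epsilon> * R = 1 / (32 * D)\<close> turns this into \<open>\<epsilon> ^ D\<close> up to a constant.
\<close>

lemma energy_lower:
  fixes L R :: nat
  defines "D \<equiv> CARD('d::finite)"
  assumes L: "1 \<le> L" and R: "1 \<le> R" and \<epsilon>: "\<epsilon> = 1 / (32 * real D * real R)"
    and small: "16 * 4 ^ D * 2 ^ (L * D) * (real L ^ D * (4 * pi * (freq_sum TYPE('d) L * \<epsilon>))) \<le> 1"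
  shows "ennreal (\<epsilon> ^ D * (1 / (64 * real D)) ^ D / 16 * real L ^ (2 * D))
    \<le> weighted_energy (freq_datum L \<epsilon>) (riesz_weight L :: (real ^ 'd) \<times> real \<Rightarrow> real)"
proof -
  define \<kappa> where "\<kappa> = real L ^ D * (4 * pi * (freq_sum TYPE('d) L * \<epsilon>))"
  define W where "W = (2::real) ^ (L * D)"
  let ?B = "cbox (\<chi> j. - real R) (\<chi> j. real R) :: (real ^ 'd) set"
  have D: "1 \<le> real D" unfolding D_def by (simp add: Suc_le_eq)
  have eps: "0 < \<epsilon>" "\<epsilon> \<le> 1" "32 * real D * real R * \<epsilon> \<le> 1"
  proof -
    have "1 \<le> 32 * real D * real R" using D R by (smt (verit) mult_le_cancel_left1 mult_mono of_nat_1 of_nat_mono)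
    then show "0 < \<epsilon>" "\<epsilon> \<le> 1" "32 * real D * real R * \<epsilon> \<le> 1" by (auto simp: \<epsilon>)
  qed
  have S: "0 \<le> freq_sum TYPE('d) L"
    unfolding freq_sum_def by (intro sum_nonneg) (simp add: less_imp_le[OF freq_pos])
  have \<kappa>: "0 \<le> \<kappa>" unfolding \<kappa>_def using S eps by simp
  have W: "1 \<le> W" unfolding W_def by simp
  have \<kappa>W: "\<kappa>\<^sup>2 * W \<le> 1 / (16 * 4 ^ D)"
  proof -
    have s: "16 * 4 ^ D * W * \<kappa> \<le> 1" using small by (simp add: \<kappa>_def W_def)
    have "1 * \<kappa> \<le> (16 * 4 ^ D * W) * \<kappa>"
      using W \<kappa> one_le_power[of "4::real" D] by (intro mult_right_mono) (smt (verit) mult_le_cancel_left1 mult_mono)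
    with s have "\<kappa> \<le> 1" by linarith
    then have "\<kappa> * \<kappa> \<le> 1 * \<kappa>" using \<kappa> by (intro mult_right_mono)
    then have "\<kappa>\<^sup>2 * W \<le> \<kappa> * W" using W by (intro mult_right_mono) (auto simp: power2_eq_square)
    also have "\<dots> \<le> 1 / (16 * 4 ^ D)" using s by (simp add: field_simps)
    finally show ?thesis .
  qed
  have pointwise: "\<epsilon> ^ (2 * D) / 8 * ((cmod (wave L x t))\<^sup>2 * riesz L x t)
      \<le> (cmod (schroedinger (freq_datum L \<epsilon>) x t))\<^sup>2 * riesz_weight L (x, t) + \<epsilon> ^ (2 * D) * (\<kappa>\<^sup>2 * W)"
    if t: "t \<in> {0..1}" and x: "x \<in> ?B" for x :: "real ^ 'd" and t
  proof -
    define u where "u = schroedinger (freq_datum L \<epsilon>) x t"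
    have "\<bar>x $ j\<bar> \<le> real R" for j using x by (auto simp: mem_box_cart abs_le_iff minus_le_iff)
    then have pk: "\<epsilon> ^ D / 2 \<le> cmod (packet \<epsilon> x t)"
      unfolding D_def using eps R t by (intro packet_lower[where r = "real R"]) (auto simp: D_def)
    have "cmod (wave L x t) * (\<epsilon> ^ D / 2) \<le> cmod (wave L x t * packet \<epsilon> x t)"
      unfolding norm_mult using pk by (intro mult_left_mono) auto
    also have "\<dots> \<le> cmod u + cmod (u - wave L x t * packet \<epsilon> x t)"
      by (metis norm_minus_commute norm_triangle_sub)
    also have "cmod (u - wave L x t * packet \<epsilon> x t) \<le> \<epsilon> ^ D * \<kappa>"
      using schroedinger_freq_datum_approx[of \<epsilon> t L x] eps t by (simp add: u_def \<kappa>_def D_def mult_ac)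
    finally have le: "cmod (wave L x t) * (\<epsilon> ^ D / 2) \<le> cmod u + \<epsilon> ^ D * \<kappa>" by simp
    have "(cmod (wave L x t) * (\<epsilon> ^ D / 2))\<^sup>2 \<le> (cmod u + \<epsilon> ^ D * \<kappa>)\<^sup>2"
      using le eps by (intro power_mono) auto
    also have "\<dots> \<le> 2 * (cmod u)\<^sup>2 + 2 * (\<epsilon> ^ D * \<kappa>)\<^sup>2"
      using sum_squares_bound[of "cmod u" "\<epsilon> ^ D * \<kappa>"] by (simp add: power2_sum)
    finally have sq: "\<epsilon> ^ (2 * D) / 8 * (cmod (wave L x t))\<^sup>2 \<le> (cmod u)\<^sup>2 + \<epsilon> ^ (2 * D) * \<kappa>\<^sup>2"
      unfolding power_even_eq by (simp add: power_mult_distrib power_divide field_simps)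
    have "\<epsilon> ^ (2 * D) / 8 * ((cmod (wave L x t))\<^sup>2 * riesz L x t) \<le> ((cmod u)\<^sup>2 + \<epsilon> ^ (2 * D) * \<kappa>\<^sup>2) * riesz L x t"
      using mult_right_mono[OF sq riesz_nonneg[of L x t]] by (simp add: mult.assoc)
    also have "\<dots> = (cmod u)\<^sup>2 * riesz L x t + \<epsilon> ^ (2 * D) * (\<kappa>\<^sup>2 * riesz L x t)"
      by (simp add: distrib_right mult.assoc)
    also have "\<dots> \<le> (cmod u)\<^sup>2 * riesz L x t + \<epsilon> ^ (2 * D) * (\<kappa>\<^sup>2 * W)"
      using riesz_le[of L x t] eps by (intro add_left_mono mult_left_mono) (auto simp: W_def D_def)
    finally show ?thesis using t by (simp add: u_def riesz_weight_def)
  qed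
  define m where "m = (2 * real R) ^ D * (real L ^ (2 * D) * (1 / 4) ^ D)"
  define e where "e = \<epsilon> ^ (2 * D) * (\<kappa>\<^sup>2 * W)"
  have e: "0 \<le> e" using eps W by (simp add: e_def)
  have [measurable]: "(\<lambda>z :: real \<times> (real ^ 'd). schroedinger (freq_datum L \<epsilon>) (snd z) (fst z)) \<in> borel_measurable (borel \<Otimes>\<^sub>M borel)"
    unfolding schroedinger_def by measurable
  have "ennreal (\<epsilon> ^ (2 * D) / 8 * m) = ennreal (\<epsilon> ^ (2 * D) / 8) * ennreal m"
    using eps by (intro ennreal_mult') auto
  also have "\<dots> \<le> ennreal (\<epsilon> ^ (2 * D) / 8) * (\<integral>\<^sup>+t\<in>{0..1}. (\<integral>\<^sup>+x. ennreal ((cmod (wave L x t))\<^sup>2 * riesz L x t) *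
          indicator ?B x \<partial>lborel) \<partial>lborel)"
    unfolding m_def D_def by (intro mult_left_mono wave_riesz_mean) auto
  also have "\<dots> = (\<integral>\<^sup>+t\<in>{0..1}. (\<integral>\<^sup>+x. ennreal (\<epsilon> ^ (2 * D) / 8) * (ennreal ((cmod (wave L x t))\<^sup>2 * riesz L x t) *
          indicator ?B x) \<partial>lborel) \<partial>lborel)"
  proof -
    have [measurable]: "(\<lambda>z. wave L (f z :: real ^ 'd) (g z)) \<in> borel_measurable M"
      if [measurable]: "f \<in> borel_measurable M" "g \<in> borel_measurable M" for f g and M :: "(real \<times> (real ^ 'd)) measure"
      unfolding wave_def by measurable
    have [measurable]: "(\<lambda>z. wave L (f z :: real ^ 'd) (g z)) \<in> borel_measurable M"
      if [measurable]: "f \<in> borel_measurable M" "g \<in> borel_measurable M" for f g and M :: "(real ^ 'd) measure"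
      unfolding wave_def by measurable
    show ?thesis
      by (subst nn_integral_cmult[symmetric], measurable) (simp add: nn_integral_cmult mult.assoc)
  qed
  also have "\<dots> \<le> (\<integral>\<^sup>+t\<in>{0..1}. ((\<integral>\<^sup>+x. ennreal ((cmod (schroedinger (freq_datum L \<epsilon>) (x :: real ^ 'd) t))\<^sup>2 * riesz_weight L (x, t)) \<partial>lborel)
        + ennreal (e * (2 * real R) ^ D)) \<partial>lborel)"
  proof (rule nn_integral_mono)
    fix t :: real
    show "(\<integral>\<^sup>+x. ennreal (\<epsilon> ^ (2 * D) / 8) * (ennreal ((cmod (wave L x t))\<^sup>2 * riesz L x t) * indicator ?B x) \<partial>lborel) * indicator {0..1} t
      \<le> ((\<integral>\<^sup>+x. ennreal ((cmod (schroedinger (freq_datum L \<epsilon>) (x :: real ^ 'd) t))\<^sup>2 * riesz_weight L (x, t)) \<partial>lborel) + ennreal (e * (2 * real R) ^ D)) * indicator {0..1} t"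
    proof (cases "t \<in> {0..1}")
      case True
      have "(\<integral>\<^sup>+x. ennreal (\<epsilon> ^ (2 * D) / 8) * (ennreal ((cmod (wave L x t))\<^sup>2 * riesz L x t) * indicator ?B x) \<partial>lborel)
        \<le> (\<integral>\<^sup>+x. ennreal ((cmod (schroedinger (freq_datum L \<epsilon>) (x :: real ^ 'd) t))\<^sup>2 * riesz_weight L (x, t)) + ennreal e * indicator ?B x \<partial>lborel)"
      proof (rule nn_integral_mono)
        fix x :: "real ^ 'd"
        show "ennreal (\<epsilon> ^ (2 * D) / 8) * (ennreal ((cmod (wave L x t))\<^sup>2 * riesz L x t) * indicator ?B x)
          \<le> ennreal ((cmod (schroedinger (freq_datum L \<epsilon>) x t))\<^sup>2 * riesz_weight L (x, t)) + ennreal e * indicator ?B x"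
        proof (cases "x \<in> ?B")
          case x: True
          have "ennreal (\<epsilon> ^ (2 * D) / 8) * ennreal ((cmod (wave L x t))\<^sup>2 * riesz L x t)
            = ennreal (\<epsilon> ^ (2 * D) / 8 * ((cmod (wave L x t))\<^sup>2 * riesz L x t))"
            using eps by (intro ennreal_mult'[symmetric]) auto
          also have "\<dots> \<le> ennreal ((cmod (schroedinger (freq_datum L \<epsilon>) x t))\<^sup>2 * riesz_weight L (x, t) + e)"
            using pointwise[OF True x] by (intro ennreal_leI) (simp add: e_def)
          also have "\<dots> = ennreal ((cmod (schroedinger (freq_datum L \<epsilon>) x t))\<^sup>2 * riesz_weight L (x, t)) + ennreal e"
            using e by (intro ennreal_plus) (auto simp: riesz_weight_def riesz_nonneg)
          finally show ?thesis using x by simp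
        qed simp
      qed
      also have "\<dots> = (\<integral>\<^sup>+x. ennreal ((cmod (schroedinger (freq_datum L \<epsilon>) (x :: real ^ 'd) t))\<^sup>2 * riesz_weight L (x, t)) \<partial>lborel) + ennreal e * emeasure lborel ?B"
      proof -
        have [measurable]: "(\<lambda>x :: real ^ 'd. riesz_weight L (x, t)) \<in> borel_measurable borel"
          unfolding riesz_weight_def by simp measurable
        have [measurable]: "(\<lambda>x :: real ^ 'd. schroedinger (freq_datum L \<epsilon>) x t) \<in> borel_measurable borel"
          unfolding schroedinger_def by measurable
        show ?thesis by (subst nn_integral_add) (simp_all add: nn_integral_cmult_indicator)
      qed
      also have "emeasure lborel ?B = ennreal ((2 * real R) ^ D)"
      proof (subst emeasure_lborel_cbox)
        show "(\<chi> j. - real R) \<bullet> b \<le> (\<chi> j. real R) \<bullet> b" if "b \<in> Basis" for b :: "real ^ 'd"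
          using that by (auto simp: Basis_vec_def inner_axis)
        show "ennreal (\<Prod>b\<in>Basis. ((\<chi> j. real R) - (\<chi> j. - real R)) \<bullet> (b :: real ^ 'd)) = ennreal ((2 * real R) ^ D)"
          unfolding prod_Basis_vec by (simp add: inner_axis D_def)
      qed
      also have "ennreal e * ennreal ((2 * real R) ^ D) = ennreal (e * (2 * real R) ^ D)"
        using e by (intro ennreal_mult'[symmetric])
      finally show ?thesis using True by simp
    qed simp
  qed
  also have "\<dots> = weighted_energy (freq_datum L \<epsilon>) (riesz_weight L :: (real ^ 'd) \<times> real \<Rightarrow> real) + ennreal (e * (2 * real R) ^ D)"
  proof -
    have [measurable]: "(\<lambda>z :: real \<times> (real ^ 'd). riesz_weight L (snd z, fst z)) \<in> borel_measurable (borel \<Otimes>\<^sub>M borel)"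
      unfolding riesz_weight_def by simp measurable
    show ?thesis
      unfolding weighted_energy_def distrib_right
      by (subst nn_integral_add) (simp_all add: nn_integral_cmult_indicator)
  qed
  finally have main: "ennreal (\<epsilon> ^ (2 * D) / 8 * m) \<le> weighted_energy (freq_datum L \<epsilon>) (riesz_weight L :: (real ^ 'd) \<times> real \<Rightarrow> real) + ennreal (e * (2 * real R) ^ D)" .
  have "\<epsilon> ^ D * (1 / (64 * real D)) ^ D / 16 * real L ^ (2 * D) \<le> \<epsilon> ^ (2 * D) / 8 * m - e * (2 * real R) ^ D"
  proof -
    define V where "V = \<epsilon> ^ (2 * D) * (2 * real R) ^ D"
    have "\<epsilon> * (2 * real R) * (1 / 4) = 1 / (64 * real D)" using R D by (simp add: \<epsilon>)
    then have "\<epsilon> ^ D * (1 / (64 * real D)) ^ D = \<epsilon> ^ D * (\<epsilon> * (2 * real R) * (1 / 4)) ^ D" by (simp only:)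
    also have "\<dots> = V * (1 / 4) ^ D"
      unfolding V_def power_even_eq power2_eq_square by (simp only: power_mult_distrib mult_ac)
    finally have V4: "\<epsilon> ^ D * (1 / (64 * real D)) ^ D = V * (1 / 4) ^ D" .
    have "1 \<le> real L ^ (2 * D)" using L by simp
    have "e * (2 * real R) ^ D = V * (\<kappa>\<^sup>2 * W)" by (simp add: e_def V_def)
    also have "\<dots> \<le> V * (1 / (16 * 4 ^ D))"
      using \<kappa>W eps by (intro mult_left_mono) (auto simp: V_def)
    also have "\<dots> = V * (1 / 4) ^ D / 16 * 1" by (simp add: power_divide)
    also have "\<dots> \<le> V * (1 / 4) ^ D / 16 * real L ^ (2 * D)"
      using \<open>1 \<le> real L ^ (2 * D)\<close> eps by (intro mult_left_mono) (auto simp: V_def)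
    finally have "e * (2 * real R) ^ D \<le> V * (1 / 4) ^ D / 16 * real L ^ (2 * D)" .
    moreover have "\<epsilon> ^ (2 * D) / 8 * m = 2 * (V * (1 / 4) ^ D / 16 * real L ^ (2 * D))"
      by (simp add: m_def V_def)
    ultimately show ?thesis unfolding V4 by linarith
  qed
  then have "ennreal (\<epsilon> ^ D * (1 / (64 * real D)) ^ D / 16 * real L ^ (2 * D)) \<le> ennreal (\<epsilon> ^ (2 * D) / 8 * m) - ennreal (e * (2 * real R) ^ D)"
    using e by (subst ennreal_minus) (auto intro!: ennreal_leI)
  also have "\<dots> \<le> weighted_energy (freq_datum L \<epsilon>) (riesz_weight L :: (real ^ 'd) \<times> real \<Rightarrow> real)"
    using main by (subst ennreal_minus_le_iff) (auto simp: add.commute)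
  finally show ?thesis .
qed

section \<open>The lower bounds for the constants\<close>

lemma ennreal_le_quotient:
  assumes "ennreal a \<le> C * ennreal s" "s > 0"
  shows "ennreal (a / s) \<le> C"
proof (cases C)
  case (real c)
  then have "ennreal a \<le> ennreal (c * s)" using assms by (simp add: ennreal_mult)
  then have "a \<le> c * s" using real assms(2) by (simp add: ennreal_le_iff)
  then have "a / s \<le> c" using assms(2) by (simp add: pos_divide_le_eq)
  then show ?thesis unfolding real(2) by (rule ennreal_leI)
qed simp

lemma node_bounds:
  fixes \<sigma> :: "'d::finite \<Rightarrow> nat"
  assumes "\<sigma> \<in> choices L"
  shows "0 < node \<sigma> $ j" and "node \<sigma> $ j + 1 \<le> (2 * real CARD('d) + 2) ^ (L * CARD('d))"
proof -
  show "0 < node \<sigma> $ j" by (simp add: node_def freq_pos)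
  let ?B = "2 * real CARD('d) + 2"
  have "expo (\<sigma> j, j) < L * CARD('d)"
  proof -
    have "Suc (\<sigma> j) * CARD('d) \<le> L * CARD('d)"
      using assms by (intro mult_right_mono) (auto simp: choices_def Suc_le_eq)
    then show ?thesis using label_less[of j] by (simp add: expo_def)
  qed
  then have "?B ^ Suc (expo (\<sigma> j, j)) \<le> ?B ^ (L * CARD('d))"
    by (intro power_increasing) auto
  moreover have "1 \<le> ?B ^ expo (\<sigma> j, j)" by (intro one_le_power) simp
  moreover have "2 * ?B ^ expo (\<sigma> j, j) \<le> ?B ^ Suc (expo (\<sigma> j, j))"
    by (simp add: distrib_right)
  moreover have "node \<sigma> $ j = ?B ^ expo (\<sigma> j, j)" by (simp add: node_def freq_def)
  ultimately show "node \<sigma> $ j + 1 \<le> ?B ^ (L * CARD('d))" by linarith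
qed

definition bound_const :: "'d::finite itself \<Rightarrow> real" where
  "bound_const _ = (1 / (64 * real CARD('d))) ^ CARD('d) / 32"

lemma bound_const_pos: "0 < bound_const TYPE('d::finite)"
  by (simp add: bound_const_def)

text \<open>
  The number \<open>T\<close> bounds both \<open>L\<^sup>2\<close> norms. Both inequalities are tested with this pair: near the support
  of \<open>g\<close> all line integrals are at most \<open>2\<close>, so either right-hand side is at most \<open>2 * T\<close> times the constant.
\<close>

lemma extremal_pair:
  fixes L :: nat and N :: real
  assumes L: "1 \<le> L" and N: "(2 * real CARD('d::finite) + 2) ^ (L * CARD('d)) \<le> N"
  obtains w :: "(real ^ 'd) \<times> real \<Rightarrow> real" and u0 g :: "real ^ 'd \<Rightarrow> complex" and T :: real
  where "weight w" "is_fourier_transform u0 g" "ess_support g \<subseteq> freq_cube N" "T > 0"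
    "L2_norm_sq u0 \<le> ennreal T" "L2_norm_sq g \<le> ennreal T"
    "\<And>x v. v \<in> ess_support g \<or> g v \<noteq> 0 \<Longrightarrow> rho_star w x v \<le> 2"
    "ennreal (2 * T * (bound_const TYPE('d) * real L ^ CARD('d))) \<le> weighted_energy g w"
proof -
  define D where "D = CARD('d)"
  \<comment> \<open>The box size R is chosen last: it makes the two errors, bounded by X and Y times the width, small.\<close>
  define X where "X = 16 * 4 ^ D * 2 ^ (L * D) * (real L ^ D * (4 * pi * freq_sum TYPE('d) L))"
  define Y where "Y = 2 ^ (L * D) * (4 * pi * freq_sum TYPE('d) L)"
  obtain R0 :: nat where R0: "max X Y \<le> real R0" using real_arch_simple by blast
  define R where "R = Suc R0"
  have R: "1 \<le> R" "X \<le> real R" "Y \<le> real R" using R0 by (auto simp: R_def)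
  define \<epsilon> where "\<epsilon> = 1 / (32 * real D * real R)"
  have D: "1 \<le> real D" by (simp add: D_def Suc_le_eq)
  have RD: "real R \<le> real D * real R" using D R by simp
  have eps: "0 < \<epsilon>" using D R by (simp add: \<epsilon>_def)
  have eps_R: "\<epsilon> * real R \<le> 1 / 32" using D R by (simp add: \<epsilon>_def field_simps)
  have "\<epsilon> * 1 \<le> \<epsilon> * real R" using eps R by (intro mult_left_mono) auto
  with eps_R have eps_le: "\<epsilon> < 1 / 2" "\<epsilon> \<le> 1" by auto
  have X\<epsilon>: "X * \<epsilon> \<le> 1" and Y\<epsilon>: "Y * \<epsilon> \<le> 1"
    using mult_right_mono[OF R(2) less_imp_le[OF eps]] mult_right_mono[OF R(3) less_imp_le[OF eps]]
      eps_R mult.commute[of \<epsilon> "real R"] by linarith+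
  have rho: "rho_star (riesz_weight L) x v \<le> 2"
    if "v \<in> ess_support (freq_datum L \<epsilon>) \<or> freq_datum L \<epsilon> v \<noteq> 0" for x v :: "real ^ 'd"
  proof -
    have "\<exists>\<sigma>. \<forall>j. \<bar>v $ j - node \<sigma> $ j\<bar> \<le> \<epsilon>"
      using that
    proof
      assume "v \<in> ess_support (freq_datum L \<epsilon>)"
      then show ?thesis by (rule ess_support_freq_datum[OF eps]) blast
    next
      assume "freq_datum L \<epsilon> v \<noteq> 0"
      then show ?thesis by (rule freq_datum_nonzeroE[OF eps]) blast
    qed
    then obtain \<sigma> where "\<And>j. \<bar>v $ j - node \<sigma> $ j\<bar> \<le> \<epsilon>" by blast
    then show ?thesis
      by (rule rho_star_riesz_weight_le) (use Y\<epsilon> in \<open>simp add: Y_def D_def mult_ac\<close>)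
  qed
  have supp: "ess_support (freq_datum L \<epsilon> :: real ^ 'd \<Rightarrow> complex) \<subseteq> freq_cube N"
  proof
    fix v :: "real ^ 'd" assume "v \<in> ess_support (freq_datum L \<epsilon>)"
    then obtain \<sigma> where \<sigma>: "\<sigma> \<in> choices L" "\<And>j. \<bar>v $ j - node \<sigma> $ j\<bar> \<le> \<epsilon>"
      using ess_support_freq_datum[OF eps] by blast
    have "\<bar>v $ j\<bar> \<le> N" for j
      using node_bounds[OF \<sigma>(1), of j] \<sigma>(2)[of j] N eps_le by linarith
    then show "v \<in> freq_cube N" by (auto simp: freq_cube_def mem_box_cart abs_le_iff minus_le_iff)
  qed
  define T where "T = real L ^ D * \<epsilon> ^ D"
  have "2 * T * (bound_const TYPE('d) * real L ^ CARD('d)) = \<epsilon> ^ D * (1 / (64 * real D)) ^ D / 16 * real L ^ (2 * D)"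
    by (simp add: T_def bound_const_def D_def power_even_eq power2_eq_square)
  also have "ennreal \<dots> \<le> weighted_energy (freq_datum L \<epsilon>) (riesz_weight L :: (real ^ 'd) \<times> real \<Rightarrow> real)"
    unfolding D_def by (rule energy_lower[OF L R(1)]) (use X\<epsilon> in \<open>simp_all add: \<epsilon>_def D_def X_def mult_ac\<close>)
  finally have energy: "ennreal (2 * T * (bound_const TYPE('d) * real L ^ CARD('d)))
    \<le> weighted_energy (freq_datum L \<epsilon>) (riesz_weight L :: (real ^ 'd) \<times> real \<Rightarrow> real)" .
  show thesis
  proof (rule that[OF weight_riesz_weight is_fourier_transform_space_datum[OF eps eps_le(1)] supp])
    show "T > 0" using L eps by (simp add: T_def)
    show "L2_norm_sq (space_datum L \<epsilon> :: real ^ 'd \<Rightarrow> complex) \<le> ennreal T"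
      unfolding T_def D_def by (rule space_datum_L2(2)[OF eps eps_le(2)])
    show "L2_norm_sq (freq_datum L \<epsilon> :: real ^ 'd \<Rightarrow> complex) \<le> ennreal T"
      unfolding T_def D_def by (rule freq_datum_L2(2)[OF eps eps_le(1)])
  qed (rule rho energy | assumption)+
qed

lemma S_admissible_lower:
  assumes L: "1 \<le> L" and N: "(2 * real CARD('d::finite) + 2) ^ (L * CARD('d)) \<le> N"
    and C: "S_admissible TYPE('d) N C"
  shows "ennreal (bound_const TYPE('d) * real L ^ CARD('d)) \<le> C"
proof -
  obtain w :: "(real ^ 'd) \<times> real \<Rightarrow> real" and u0 g :: "real ^ 'd \<Rightarrow> complex" and T
  where *: "weight w" "is_fourier_transform u0 g" "ess_support g \<subseteq> freq_cube N" "T > 0"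
    "L2_norm_sq u0 \<le> ennreal T" "L2_norm_sq g \<le> ennreal T"
    "\<And>x v. v \<in> ess_support g \<or> g v \<noteq> 0 \<Longrightarrow> rho_star w x v \<le> 2"
    "ennreal (2 * T * (bound_const TYPE('d) * real L ^ CARD('d))) \<le> weighted_energy g w"
    by (rule extremal_pair[OF L N]) (rule that; assumption)
  have [measurable]: "g \<in> borel_measurable borel"
    using *(2) by (simp add: is_fourier_transform_def square_integrable_def)
  have "(\<integral>\<^sup>+ v. ennreal ((cmod (g v))\<^sup>2) * (SUP x. rho_star w x v) \<partial>lebesgue)
    \<le> (\<integral>\<^sup>+ v. ennreal ((cmod (g v))\<^sup>2) * 2 \<partial>lebesgue)"
  proof (rule nn_integral_mono)
    fix v
    show "ennreal ((cmod (g v))\<^sup>2) * (SUP x. rho_star w x v) \<le> ennreal ((cmod (g v))\<^sup>2) * 2"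
    proof (cases "g v = 0")
      case False
      then show ?thesis by (intro mult_left_mono SUP_least *(7)) auto
    qed simp
  qed
  also have "\<dots> = L2_norm_sq g * 2"
    unfolding nn_integral_completion L2_norm_sq_def by (rule nn_integral_multc) measurable
  also have "\<dots> \<le> ennreal T * 2" by (intro mult_right_mono *(6)) auto
  also have "\<dots> = ennreal (2 * T)"
    using *(4) by (simp add: ennreal_mult mult.commute)
  finally have rhs: "(\<integral>\<^sup>+ v. ennreal ((cmod (g v))\<^sup>2) * (SUP x. rho_star w x v) \<partial>lebesgue) \<le> ennreal (2 * T)" .
  have "weighted_energy g w \<le> C * (\<integral>\<^sup>+ v. ennreal ((cmod (g v))\<^sup>2) * (SUP x. rho_star w x v) \<partial>lebesgue)"
    using C *(1-3) unfolding S_admissible_def by blast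
  also have "\<dots> \<le> C * ennreal (2 * T)" by (intro mult_left_mono rhs) auto
  finally have "ennreal (2 * T * (bound_const TYPE('d) * real L ^ CARD('d))) \<le> C * ennreal (2 * T)"
    using *(8) by (rule order_trans[rotated])
  then have "ennreal (2 * T * (bound_const TYPE('d) * real L ^ CARD('d)) / (2 * T)) \<le> C"
    using *(4) by (intro ennreal_le_quotient) simp_all
  moreover have "2 * T * (bound_const TYPE('d) * real L ^ CARD('d)) / (2 * T) = bound_const TYPE('d) * real L ^ CARD('d)"
    using *(4) by simp
  ultimately show ?thesis by (simp only:)
qed

lemma M_admissible_lower:
  assumes L: "1 \<le> L" and N: "(2 * real CARD('d::finite) + 2) ^ (L * CARD('d)) \<le> N"
    and C: "M_admissible TYPE('d) N C"
  shows "ennreal (bound_const TYPE('d) * real L ^ CARD('d)) \<le> C"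
proof -
  obtain w :: "(real ^ 'd) \<times> real \<Rightarrow> real" and u0 g :: "real ^ 'd \<Rightarrow> complex" and T
  where *: "weight w" "is_fourier_transform u0 g" "ess_support g \<subseteq> freq_cube N" "T > 0"
    "L2_norm_sq u0 \<le> ennreal T" "L2_norm_sq g \<le> ennreal T"
    "\<And>x v. v \<in> ess_support g \<or> g v \<noteq> 0 \<Longrightarrow> rho_star w x v \<le> 2"
    "ennreal (2 * T * (bound_const TYPE('d) * real L ^ CARD('d))) \<le> weighted_energy g w"
    by (rule extremal_pair[OF L N]) (rule that; assumption)
  have "weighted_energy g w \<le> C * (SUP (x, v) \<in> UNIV \<times> ess_support g. rho_star w x v) * L2_norm_sq u0"
    using C *(1-3) unfolding M_admissible_def by blast
  also have "\<dots> \<le> C * 2 * ennreal T"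
    using *(5,7) by (intro mult_mono mult_left_mono SUP_least) auto
  also have "\<dots> = C * ennreal (2 * T)"
    using *(4) by (simp add: ennreal_mult mult.assoc)
  finally have "ennreal (2 * T * (bound_const TYPE('d) * real L ^ CARD('d))) \<le> C * ennreal (2 * T)"
    using *(8) by (rule order_trans[rotated])
  then have "ennreal (2 * T * (bound_const TYPE('d) * real L ^ CARD('d)) / (2 * T)) \<le> C"
    using *(4) by (intro ennreal_le_quotient) simp_all
  moreover have "2 * T * (bound_const TYPE('d) * real L ^ CARD('d)) / (2 * T) = bound_const TYPE('d) * real L ^ CARD('d)"
    using *(4) by simp
  ultimately show ?thesis by (simp only:)
qed

lemma scale_choice:
  fixes N b :: real and D :: nat
  assumes b: "b > 1" and D: "D \<ge> 1" and N: "b ^ D \<le> N"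
  obtains L :: nat where "1 \<le> L" "b ^ (L * D) \<le> N" "ln N / (2 * real D * ln b) \<le> real L"
proof -
  define q where "q = ln N / (real D * ln b)"
  define L where "L = nat \<lfloor>q\<rfloor>"
  have lb: "ln b > 0" using b by simp
  have N0: "N > 0" using N b by (smt (verit) zero_less_power)
  have "ln (b ^ D) \<le> ln N" using N N0 b by (subst ln_le_cancel_iff) auto
  then have q1: "1 \<le> q" using lb D b by (simp add: q_def ln_realpow)
  have L1: "1 \<le> L" and Lq: "real L \<le> q" and qL: "q < real L + 1"
    using q1 unfolding L_def by linarith+
  have "real (L * D) * ln b \<le> ln N"
    using mult_right_mono[OF Lq, of "real D * ln b"] lb D by (simp add: q_def mult.assoc)
  then have "ln (b ^ (L * D)) \<le> ln N" using b by (simp add: ln_realpow)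
  then have "b ^ (L * D) \<le> N" using N0 b by (subst (asm) ln_le_cancel_iff) auto
  moreover have "q / 2 \<le> real L" using q1 qL L1 by linarith
  then have "ln N / (2 * real D * ln b) \<le> real L" by (simp add: q_def mult_ac)
  ultimately show thesis using that L1 by blast
qed

lemma log_power_lower_bound:
  fixes F :: "real \<Rightarrow> ennreal"
  assumes "\<And>L N. 1 \<le> L \<Longrightarrow> (2 * real CARD('d::finite) + 2) ^ (L * CARD('d)) \<le> N \<Longrightarrow>
      ennreal (bound_const TYPE('d) * real L ^ CARD('d)) \<le> F N"
  shows "\<exists>c > 0. \<forall>\<^sub>F N in at_top. ennreal (c * (ln N) ^ CARD('d)) \<le> F N"
proof -
  define D where "D = CARD('d)"
  define b where "b = 2 * real D + 2"
  define c where "c = bound_const TYPE('d) / (2 * real D * ln b) ^ D"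
  have D: "1 \<le> D" by (simp add: D_def Suc_le_eq)
  have b: "b > 1" by (simp add: b_def)
  have "c > 0" using D b by (simp add: c_def bound_const_pos)
  moreover have "\<forall>\<^sub>F N in at_top. ennreal (c * (ln N) ^ D) \<le> F N"
    using eventually_ge_at_top[of "b ^ D"]
  proof eventually_elim
    case (elim N)
    obtain L where L: "1 \<le> L" "b ^ (L * D) \<le> N" "ln N / (2 * real D * ln b) \<le> real L"
      using scale_choice[OF b D elim] by blast
    have "1 \<le> N" using elim b one_le_power[of b D] by linarith
    have "c * (ln N) ^ D = bound_const TYPE('d) * (ln N / (2 * real D * ln b)) ^ D"
      by (simp add: c_def power_divide)
    also have "\<dots> \<le> bound_const TYPE('d) * real L ^ D"
      using L(3) \<open>1 \<le> N\<close> b by (intro mult_left_mono power_mono less_imp_le[OF bound_const_pos]) auto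
    finally have "ennreal (c * (ln N) ^ D) \<le> ennreal (bound_const TYPE('d) * real L ^ D)"
      by (rule ennreal_leI)
    also have "\<dots> \<le> F N" using assms[of L N] L by (simp add: D_def b_def)
    finally show ?case .
  qed
  ultimately show ?thesis unfolding D_def by blast
qed

theorem mainTheorem5:
  "(\<exists>c > 0. \<forall>\<^sub>F N :: real in at_top.
      S_const TYPE('d::finite) N \<ge> ennreal (c * (ln N) ^ CARD('d))) \<and>
   (\<exists>c > 0. \<forall>\<^sub>F N :: real in at_top.
      M_const TYPE('d) N \<ge> ennreal (c * (ln N) ^ CARD('d)))"
proof (rule conjI; rule log_power_lower_bound)
  fix L :: nat and N :: real
  assume "1 \<le> L" "(2 * real CARD('d) + 2) ^ (L * CARD('d)) \<le> N"
  then show "ennreal (bound_const TYPE('d) * real L ^ CARD('d)) \<le> S_const TYPE('d) N"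
    unfolding S_const_def by (blast intro: Inf_greatest S_admissible_lower)
next
  fix L :: nat and N :: real
  assume "1 \<le> L" "(2 * real CARD('d) + 2) ^ (L * CARD('d)) \<le> N"
  then show "ennreal (bound_const TYPE('d) * real L ^ CARD('d)) \<le> M_const TYPE('d) N"
    unfolding M_const_def by (blast intro: Inf_greatest M_admissible_lower)
qed

end
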